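(* (A) Let $\mathcal F=\{\mathfrak G_s=(X_s,d_s)\}_{s\in S}$ be a productable collection of AB-HO metric spaces and let $\preccurlyeq$ be a total order on $S$ such that $\mathrm{card}(\mathrm{supp}(\mathcal F))>1$ and the product $\mathfrak H=(Z,\rho):={}^{\preccurlyeq}\!\prod^*_{s\in S}\mathfrak G_s$ is a metric space. Then $\mathfrak H$ is Heine-Borel if and only if one of the following conditions is fulfilled: • $\mathrm{supp}(\mathcal F)$ is finite, with the least and the greatest elements, say, $p$ and $q$ (respectively), the space $\mathfrak G_q$ is compact, $\mathfrak G_p$ is Heine-Borel and topologically discrete, and all other spaces $X_s$ ($s\in\mathrm{supp}(\mathcal F)$) are finite; or • $\mathrm{supp}(\mathcal F)$ has the least element, say $a$, is order-isomorphic to $\mathbb N$, $\mathfrak G_a$ is Heine-Borel and topologically discrete, and all other spaces $X_s$ are finite and their diameters tend to $0$ as $s\in\mathrm{supp}(\mathcal F)$ increases; or • $\mathrm{supp}(\mathcal F)$ has the greatest element, say $b$, is order-isomorphic to the set $\mathbb Z_-$ of all negative integers, $\mathfrak G_b$ is compact and all other spaces $X_s$ are finite and their co-diameters tend to $\infty$ as $s\in\mathrm{supp}(\mathcal F)$ decreases; or • $\mathrm{supp}(\mathcal F)$ is order-isomorphic to $\mathbb Z$, all spaces $X_s$ are finite, their diameters tend to $0$ as $s\in\mathrm{supp}(\mathcal F)$ increases and their co-diameters tend to $\infty$ as $s\in\mathrm{supp}(\mathcal F)$ decreases. In particular, the product $\mathfrak G_1\times^*\cdots\times^*\mathfrak G_r$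 of a finite productable collection $\{\mathfrak G_1,\ldots,\mathfrak G_r\}$ of AB-HO Heine-Borel metric spaces is Heine-Borel as well, provided it is a metric space. (B) Each of the following topological spaces admits a compatible metric that makes it both AB-HO and Heine-Borel: (a) an at most countable discrete topological space; (b) $\mathbb R^n$ where $n>0$ is finite; (c) $\mathbb S^n\times D$ where $n>0$ is finite, $\mathbb S^n$ is the $n$-dimensional sphere and $D\neq\varnothing$ is an at most countable discrete topological space; (d) the Cantor set $\mathcal C$; (e) $\mathcal C\times D$ where $\mathcal C$ is the Cantor set and $D$ is an infinite countable discrete topological space.
   Context: A metric space is absolutely homogeneous (AB-HO) if every isometric map from a subset of it into it extends to an isometry of the space onto itself. It is Heine-Borel if all its closed balls are compact. The co-diameter of a finite metric space with more than one point is its least positive distance. $\mathbb N=\{0,1,2,\ldots\}$. A collection $\mathcal F=\{\mathfrak G_s=(X_s,d_s)\}_{s\in S}$ of metric spaces is productable if $S\neq\varnothing$, all $X_s$ are non-empty, and for distinct $s_1,s_2\in S$ the sets of positive distances attained in $\mathfrak G_{s_1}$ and in $\mathfrak G_{s_2}$ are disjoint. Its support $\mathrm{supp}(\mathcal F)$ is the set of $s\in S$ such that $X_s$ has more than one point (ordered by the order of $S$). For $\mathfrak x,\mathfrak y\in\prod_{s\in S}X_s$ put $\mathrm{Diff}(\mathfrak x,\mathfrak y)=\{s: x_s\neq y_s\}$. For a total order $\preccurlyeq$ on $S$ and $\mathfrak a\in\prod_{s\in S}X_s$, the product ${}^{\preccurlyeq}\!\prod^{\mathfrak a}_{s\in S}\mathfrak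 G_s$ is the pair $(Z,\rho)$ where $Z$ consists of all $\mathfrak x\in\prod_{s\in S}X_s$ such that $\mathrm{Diff}(\mathfrak x,\mathfrak a)$ is well-ordered by $\preccurlyeq$, $\rho(\mathfrak x,\mathfrak x)=0$, and $\rho(\mathfrak x,\mathfrak y)=d_\ell(x_\ell,y_\ell)$ for $\mathfrak x\neq\mathfrak y$, where $\ell$ is the $\preccurlyeq$-least element of $\mathrm{Diff}(\mathfrak x,\mathfrak y)$. ($\rho$ need not satisfy the triangle inequality; "the product is a metric space" means that $\rho$ is a metric.) When all factors are AB-HO, up to a $\rho$-preserving bijection the product does not depend on $\mathfrak a$ and it is denoted ${}^{\preccurlyeq}\!\prod^{*}_{s\in S}\mathfrak G_s$. $\mathfrak G_1\times^*\cdots\times^*\mathfrak G_r$ denotes the product with index set $\{1,\dots,r\}$ with the natural order. *)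

theory Defs
  imports "HOL-Analysis.Analysis"
begin

section \<open>Metric spaces\<close>

definition isometry_on :: "'a metric \<Rightarrow> 'a set \<Rightarrow> ('a \<Rightarrow> 'a) \<Rightarrow> bool" where
  "isometry_on m A f \<longleftrightarrow>
     f \<in> A \<rightarrow> mspace m \<and> (\<forall>x\<in>A. \<forall>y\<in>A. mdist m (f x) (f y) = mdist m x y)"

definition absolutely_homogeneous :: "'a metric \<Rightarrow> bool" where
  "absolutely_homogeneous m \<longleftrightarrow>
     (\<forall>A f. A \<subseteq> mspace m \<and> isometry_on m A f \<longrightarrow>
        (\<exists>g. bij_betw g (mspace m) (mspace m) \<and> isometry_on m (mspace m) g \<and>
             (\<forall>x\<in>A. g x = f x)))"

definition Heine_Borel :: "'a metric \<Rightarrow> bool" where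
  "Heine_Borel m \<longleftrightarrow>
     (\<forall>x\<in>mspace m. \<forall>e. compactin (mtopology_of m) (mcball_of m x e))"

definition topologically_discrete :: "'a metric \<Rightarrow> bool" where
  "topologically_discrete m \<longleftrightarrow> mtopology_of m = discrete_topology (mspace m)"

definition positive_distances :: "'a metric \<Rightarrow> real set" where
  "positive_distances m = {mdist m x y | x y. x \<in> mspace m \<and> y \<in> mspace m \<and> x \<noteq> y}"

text \<open>The next two numbers are meaningful for nonempty finite spaces (with more than one
  point for the second one); they are only used there.\<close>

definition diam :: "'a metric \<Rightarrow> real" where
  "diam m = Sup {mdist m x y | x y. x \<in> mspace m \<and> y \<in> mspace m}"

definition codiam :: "'a metric \<Rightarrow> real" where
  "codiam m = Min (positive_distances m)"


section \<open>Ordered index sets\<close>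

text \<open>A total order on \<open>S\<close> is a relation \<open>r\<close> with \<^term>\<open>linear_order_on S r\<close>;
  \<open>(s, t) \<in> r\<close> means that \<open>s\<close> precedes or equals \<open>t\<close>.\<close>

definition is_least :: "'s rel \<Rightarrow> 's set \<Rightarrow> 's \<Rightarrow> bool" where
  "is_least r T p \<longleftrightarrow> p \<in> T \<and> (\<forall>t\<in>T. (p, t) \<in> r)"

definition is_greatest :: "'s rel \<Rightarrow> 's set \<Rightarrow> 's \<Rightarrow> bool" where
  "is_greatest r T q \<longleftrightarrow> q \<in> T \<and> (\<forall>t\<in>T. (t, q) \<in> r)"

definition order_isomorphic_to :: "'s rel \<Rightarrow> 's set \<Rightarrow> 'b::linorder set \<Rightarrow> bool" where
  "order_isomorphic_to r T B \<longleftrightarrow>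
     (\<exists>f. bij_betw f T B \<and> (\<forall>s\<in>T. \<forall>t\<in>T. (s, t) \<in> r \<longleftrightarrow> f s \<le> f t))"

definition increasing_in :: "'s rel \<Rightarrow> 's set \<Rightarrow> 's filter" where
  "increasing_in r T = (INF s\<in>T. principal {t \<in> T. (s, t) \<in> r})"

definition decreasing_in :: "'s rel \<Rightarrow> 's set \<Rightarrow> 's filter" where
  "decreasing_in r T = (INF s\<in>T. principal {t \<in> T. (t, s) \<in> r})"

lemma eventually_increasing_in:
  assumes "linear_order_on S r" "T \<subseteq> S" "T \<noteq> {}"
  shows "eventually P (increasing_in r T) \<longleftrightarrow> (\<exists>s\<in>T. \<forall>t\<in>T. (s, t) \<in> r \<longrightarrow> P t)"
proof -
  have tr: "trans r" and tot: "total_on S r" and refl: "refl_on S r"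
    using assms(1) by (auto simp: order_on_defs)
  have "eventually P (increasing_in r T) \<longleftrightarrow>
        (\<exists>s\<in>T. eventually P (principal {t \<in> T. (s, t) \<in> r}))"
    unfolding increasing_in_def
  proof (rule eventually_INF_base[OF assms(3)])
    fix a b assume ab: "a \<in> T" "b \<in> T"
    then have "(a, b) \<in> r \<or> (b, a) \<in> r"
      using tot refl assms(2) unfolding total_on_def refl_on_def by (metis subsetD)
    then show "\<exists>x\<in>T. principal {t \<in> T. (x, t) \<in> r} \<le>
      inf (principal {t \<in> T. (a, t) \<in> r}) (principal {t \<in> T. (b, t) \<in> r})"
    proof
      assume "(a, b) \<in> r"
      then have "{t \<in> T. (b, t) \<in> r} \<subseteq> {t \<in> T. (a, t) \<in> r}"
        using tr by (auto dest: transD)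
      then show ?thesis using ab by (intro bexI[of _ b]) auto
    next
      assume "(b, a) \<in> r"
      then have "{t \<in> T. (a, t) \<in> r} \<subseteq> {t \<in> T. (b, t) \<in> r}"
        using tr by (auto dest: transD)
      then show ?thesis using ab by (intro bexI[of _ a]) auto
    qed
  qed
  then show ?thesis by (auto simp: eventually_principal)
qed

lemma eventually_decreasing_in:
  assumes "linear_order_on S r" "T \<subseteq> S" "T \<noteq> {}"
  shows "eventually P (decreasing_in r T) \<longleftrightarrow> (\<exists>s\<in>T. \<forall>t\<in>T. (t, s) \<in> r \<longrightarrow> P t)"
proof -
  have "decreasing_in r T = increasing_in (r\<inverse>) T"
    by (simp add: increasing_in_def decreasing_in_def)
  then show ?thesis
    using eventually_increasing_in[of S "r\<inverse>" T P] assms by simp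
qed


section \<open>Products of metric spaces\<close>

definition productable :: "'s set \<Rightarrow> ('s \<Rightarrow> 'a metric) \<Rightarrow> bool" where
  "productable S G \<longleftrightarrow>
     S \<noteq> {} \<and> (\<forall>s\<in>S. mspace (G s) \<noteq> {}) \<and>
     (\<forall>s\<in>S. \<forall>t\<in>S. s \<noteq> t \<longrightarrow> positive_distances (G s) \<inter> positive_distances (G t) = {})"

definition supp :: "'s set \<Rightarrow> ('s \<Rightarrow> 'a metric) \<Rightarrow> 's set" where
  "supp S G = {s \<in> S. \<exists>x\<in>mspace (G s). \<exists>y\<in>mspace (G s). x \<noteq> y}"

definition Diff :: "'s set \<Rightarrow> ('s \<Rightarrow> 'a) \<Rightarrow> ('s \<Rightarrow> 'a) \<Rightarrow> 's set" where
  "Diff S x y = {s \<in> S. x s \<noteq> y s}"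

definition product_space ::
    "'s set \<Rightarrow> 's rel \<Rightarrow> ('s \<Rightarrow> 'a metric) \<Rightarrow> ('s \<Rightarrow> 'a) \<Rightarrow> ('s \<Rightarrow> 'a) set" where
  "product_space S r G a =
     {x \<in> \<Pi>\<^sub>E s\<in>S. mspace (G s). well_order_on (Diff S x a) (Restr r (Diff S x a))}"

definition product_dist ::
    "'s set \<Rightarrow> 's rel \<Rightarrow> ('s \<Rightarrow> 'a metric) \<Rightarrow> ('s \<Rightarrow> 'a) \<Rightarrow> ('s \<Rightarrow> 'a) \<Rightarrow> real" where
  "product_dist S r G x y =
     (if x = y then 0
      else let l = (THE l. is_least r (Diff S x y) l) in mdist (G l) (x l) (y l))"

definition product_is_metric ::
    "'s set \<Rightarrow> 's rel \<Rightarrow> ('s \<Rightarrow> 'a metric) \<Rightarrow> ('s \<Rightarrow> 'a) \<Rightarrow> bool" where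
  "product_is_metric S r G a \<longleftrightarrow> Metric_space (product_space S r G a) (product_dist S r G)"

text \<open>As an element of type \<^typ>\<open>('s \<Rightarrow> 'a) metric\<close> the product is only meaningful
  when \<^const>\<open>product_is_metric\<close> holds.\<close>

definition product_metric ::
    "'s set \<Rightarrow> 's rel \<Rightarrow> ('s \<Rightarrow> 'a metric) \<Rightarrow> ('s \<Rightarrow> 'a) \<Rightarrow> ('s \<Rightarrow> 'a) metric" where
  "product_metric S r G a = metric (product_space S r G a, product_dist S r G)"

text \<open>The library's locale \<^locale>\<open>Metric_space\<close> asks for nonnegativity and symmetry on the
  whole type, not just on the carrier. This costs nothing here: \<^const>\<open>product_dist\<close> always
  has these properties, so that \<^const>\<open>product_is_metric\<close> speaks about the carrier only.\<close>

lemma product_dist_nonneg: "0 \<le> product_dist S r G x y"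
  by (simp add: product_dist_def Let_def)

lemma product_dist_commute: "product_dist S r G x y = product_dist S r G y x"
proof -
  have "Diff S x y = Diff S y x" by (auto simp: Diff_def)
  then show ?thesis by (auto simp: product_dist_def Let_def mdist_commute)
qed


section \<open>Topological spaces\<close>

definition admits_AB_HO_Heine_Borel_metric :: "'a topology \<Rightarrow> bool" where
  "admits_AB_HO_Heine_Borel_metric X \<longleftrightarrow>
     (\<exists>m. mtopology_of m = X \<and> absolutely_homogeneous m \<and> Heine_Borel m)"

text \<open>The middle-thirds Cantor set.\<close>

primrec cantor_stage :: "nat \<Rightarrow> real set" where
  "cantor_stage 0 = {0..1}"
| "cantor_stage (Suc k) = (\<lambda>x. x / 3) ` cantor_stage k \<union> (\<lambda>x. (2 + x) / 3) ` cantor_stage k"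

definition cantor_set :: "real set" where
  "cantor_set = (\<Inter>k. cantor_stage k)"

end

theory Submission
  imports Defs
begin

text \<open>
  Why the characterization of Heine-Borel products holds.  The triangle inequality of the product
  says something about the factors: if \<open>s\<close> precedes \<open>t\<close>, then no distance in the factor
  \<open>t\<close> exceeds twice a positive distance in the factor \<open>s\<close>
  (\<open>dist_later_le_twice_earlier\<close>).  Hence the coordinate projections are 2-Lipschitz, every
  factor of the support except a least one is bounded, and every one except a greatest one is
  uniformly discrete.

  If the product is Heine-Borel, then so are the factors, as Lipschitz images, and a ball contains no
  infinite uniformly discrete set.  Changing the base point in one single coordinate gives such a
  set as soon as infinitely many coordinates admit a change of size between two positive bounds
  (\<open>finite_bounded_changes\<close>).  This single principle shows that intervals of the support are
  finite, that the diameters tend to 0 upwards when there is no greatest index and that, the factors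
  being homogeneous, the co-diameters tend to \<open>\<infinity>\<close> downwards when there is no least index.

  Conversely, under these conditions the points of a ball agree below some index, so that the
  ball lies in a product of compact sets.  On this box the product topology, which is compact by
  Tychonoff's theorem, is finer than the topology of \<open>\<rho>\<close>: up to any given precision, \<open>\<rho>\<close> only
  sees finitely many coordinates (\<open>locally_finite_imp_Heine_Borel\<close>).  It remains to observe that
  a total order with finite intervals is a convex subset of the integers, so that the presence or
  absence of a least and a greatest element leaves exactly the four order types.

  The examples.  Euclidean spaces are absolutely homogeneous because an isometry which agrees with
  a given partial isometry on part of its domain can be corrected at one further point by a
  reflection; each correction raises the dimension of the set of agreement
  (\<open>partial_isometry_extends\<close>).  Spheres inherit this property, and so do the multiples of 3 on the
  line, which serve as an infinite discrete space.  The Cantor set carries the ultrametric of the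
  space of binary sequences, whose partial isometries extend by flipping bits.  Finally, a
  compact space times a discrete space is metrized by putting the discrete factor first, with
  distances large compared to the compact factor.
\<close>

section \<open>Linear orders given by relations\<close>

locale linear_ordered_set =
  fixes S :: "'s set" and r :: "'s rel"
  assumes lin: "linear_order_on S r"
begin

lemma le_in: "(s, t) \<in> r \<Longrightarrow> s \<in> S" "(s, t) \<in> r \<Longrightarrow> t \<in> S"
  using lin by (auto simp: order_on_defs)

lemma le_refl: "s \<in> S \<Longrightarrow> (s, s) \<in> r"
  using lin by (auto simp: order_on_defs refl_on_def)

lemma le_antisym: "(s, t) \<in> r \<Longrightarrow> (t, s) \<in> r \<Longrightarrow> s = t"
  using lin by (auto simp: order_on_defs dest: antisymD)

lemma le_trans: "(s, t) \<in> r \<Longrightarrow> (t, u) \<in> r \<Longrightarrow> (s, u) \<in> r"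
  using lin by (auto simp: order_on_defs dest: transD)

lemma le_cases: "s \<in> S \<Longrightarrow> t \<in> S \<Longrightarrow> (s, t) \<in> r \<or> (t, s) \<in> r"
  using lin le_refl unfolding order_on_defs total_on_def by metis

lemma least_unique: "is_least r A l \<Longrightarrow> is_least r A l' \<Longrightarrow> l = l'"
  unfolding is_least_def by (metis le_antisym)

lemma finite_has_least:
  assumes "finite A" "A \<noteq> {}" "A \<subseteq> S"
  shows "\<exists>l. is_least r A l"
  using assms
proof (induction rule: finite_ne_induct)
  case (singleton x)
  then show ?case by (auto simp: is_least_def le_refl)
next
  case (insert x F)
  then obtain l where l: "is_least r F l" by auto
  have "(x, l) \<in> r \<or> (l, x) \<in> r"
    using insert.prems l le_cases by (auto simp: is_least_def)
  then show ?case
  proof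
    assume "(x, l) \<in> r"
    then have "is_least r (insert x F) x"
      using l insert.prems by (auto simp: is_least_def le_refl intro: le_trans)
    then show ?thesis by blast
  next
    assume "(l, x) \<in> r"
    then have "is_least r (insert x F) l"
      using l by (auto simp: is_least_def)
    then show ?thesis by blast
  qed
qed

lemma converse: "linear_ordered_set S (r\<inverse>)"
  using lin by unfold_locales simp

lemma finite_has_greatest:
  assumes "finite A" "A \<noteq> {}" "A \<subseteq> S"
  shows "\<exists>l. is_greatest r A l"
  using linear_ordered_set.finite_has_least[OF converse assms]
  by (simp add: is_least_def is_greatest_def)

lemma strict_upper_bound:
  assumes "finite U" "U \<subseteq> T" "T \<subseteq> S" "T \<noteq> {}" "\<nexists>q. is_greatest r T q"
  shows "\<exists>s\<in>T. \<forall>u\<in>U. (u, s) \<in> r \<and> u \<noteq> s"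
proof (cases "U = {}")
  case False
  then obtain m where m: "is_greatest r U m"
    using finite_has_greatest assms by blast
  with assms obtain s where s: "s \<in> T" "(s, m) \<notin> r"
    unfolding is_greatest_def by blast
  have "(m, s) \<in> r"
    using le_cases[of m s] s m assms(2,3) by (auto simp: is_greatest_def)
  then have "(u, s) \<in> r \<and> u \<noteq> s" if "u \<in> U" for u
    using that m s le_trans by (auto simp: is_greatest_def)
  then show ?thesis using s by blast
qed (use assms in auto)

lemma strict_lower_bound:
  assumes "finite U" "U \<subseteq> T" "T \<subseteq> S" "T \<noteq> {}" "\<nexists>q. is_least r T q"
  shows "\<exists>s\<in>T. \<forall>u\<in>U. (s, u) \<in> r \<and> u \<noteq> s"
  using linear_ordered_set.strict_upper_bound[OF converse assms(1-4)] assms(5)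
  by (simp add: is_least_def is_greatest_def)

end

text \<open>The condition on \<open>Diff\<close> in the definition of the product, in a form in which
  least elements are immediately at hand; see \<open>well_order_on_Restr_iff\<close>.\<close>

definition well_ordered_by :: "'s rel \<Rightarrow> 's set \<Rightarrow> bool" where
  "well_ordered_by r A \<longleftrightarrow> (\<forall>V\<subseteq>A. V \<noteq> {} \<longrightarrow> (\<exists>l. is_least r V l))"

lemma well_ordered_by_subset: "well_ordered_by r A \<Longrightarrow> B \<subseteq> A \<Longrightarrow> well_ordered_by r B"
  by (auto simp: well_ordered_by_def)

context linear_ordered_set
begin

lemma well_order_on_Restr_iff:
  assumes "A \<subseteq> S"
  shows "well_order_on A (Restr r A) \<longleftrightarrow> well_ordered_by r A"
proof -
  have lA: "linear_order_on A (Restr r A)"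
    using assms le_refl le_cases
    unfolding order_on_defs refl_on_def total_on_def antisym_def trans_def
    by (auto intro: le_antisym le_trans) (meson subsetD)
  have "wf (Restr r A - Id) \<longleftrightarrow> well_ordered_by r A"
  proof
    assume w: "wf (Restr r A - Id)"
    show "well_ordered_by r A"
      unfolding well_ordered_by_def
    proof (intro allI impI)
      fix V assume V: "V \<subseteq> A" "V \<noteq> {}"
      then obtain z where z: "z \<in> V" "\<And>y. (y, z) \<in> Restr r A - Id \<Longrightarrow> y \<notin> V"
        using w unfolding wf_eq_minimal by (metis ex_in_conv)
      then have "is_least r V z"
        unfolding is_least_def using V assms le_cases le_refl
        by (smt (verit) DiffI IntI SigmaI in_mono pair_in_Id_conv)
      then show "\<exists>l. is_least r V l" by blast
    qed
  next
    assume w: "well_ordered_by r A"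
    show "wf (Restr r A - Id)"
      unfolding wf_eq_minimal
    proof (intro allI impI)
      fix Q and x :: 's assume x: "x \<in> Q"
      show "\<exists>z\<in>Q. \<forall>y. (y, z) \<in> Restr r A - Id \<longrightarrow> y \<notin> Q"
      proof (cases "Q \<inter> A = {}")
        case True
        then show ?thesis using x by blast
      next
        case False
        then obtain l where l: "l \<in> Q \<inter> A" "\<And>q. q \<in> Q \<inter> A \<Longrightarrow> (l, q) \<in> r"
          using w unfolding well_ordered_by_def is_least_def by (meson inf_le2)
        have "y \<notin> Q" if "(y, l) \<in> Restr r A - Id" for y
          using that l(2)[of y] le_antisym[of y l] by auto
        then show ?thesis using l(1) by blast
      qed
    qed
  qed
  then show ?thesis using lA by (simp add: well_order_on_def)
qed

lemma well_ordered_by_Un: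
  assumes "well_ordered_by r A" "well_ordered_by r B" "A \<union> B \<subseteq> S"
  shows "well_ordered_by r (A \<union> B)"
  unfolding well_ordered_by_def
proof (intro allI impI)
  fix V assume V: "V \<subseteq> A \<union> B" "V \<noteq> {}"
  \<comment> \<open>the least elements of the two traces, where they exist\<close>
  define W where "W = {l. is_least r (V \<inter> A) l \<or> is_least r (V \<inter> B) l}"
  have fin: "finite W"
  proof -
    have "finite {l. is_least r C l}" for C
    proof (cases "\<exists>l. is_least r C l")
      case True
      then obtain l where "is_least r C l" by blast
      then have "{l. is_least r C l} \<subseteq> {l}" using least_unique by blast
      then show ?thesis using finite_subset by blast
    qed simp
    then show ?thesis by (simp add: W_def)
  qed
  have below: "\<exists>l\<in>W. (l, v) \<in> r" if "v \<in> V" for v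
  proof -
    have "v \<in> V \<inter> A \<or> v \<in> V \<inter> B" using that V by blast
    then show ?thesis
    proof
      assume v: "v \<in> V \<inter> A"
      then obtain l where "is_least r (V \<inter> A) l"
        using assms(1) unfolding well_ordered_by_def by blast
      then show ?thesis using v by (auto simp: W_def is_least_def)
    next
      assume v: "v \<in> V \<inter> B"
      then obtain l where "is_least r (V \<inter> B) l"
        using assms(2) unfolding well_ordered_by_def by blast
      then show ?thesis using v by (auto simp: W_def is_least_def)
    qed
  qed
  have WV: "W \<subseteq> V" by (auto simp: W_def is_least_def)
  moreover have "W \<noteq> {}" using below V by blast
  ultimately obtain l where l: "is_least r W l"
    using finite_has_least[OF fin] V assms(3) by blast
  then have "is_least r V l"
    unfolding is_least_def using below WV le_trans by blast
  then show "\<exists>l. is_least r V l" by blast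
qed

lemma well_ordered_by_finite: "finite A \<Longrightarrow> A \<subseteq> S \<Longrightarrow> well_ordered_by r A"
  unfolding well_ordered_by_def
  by (intro allI impI finite_has_least) (auto intro: finite_subset)

text \<open>Below a given element of a nonempty subset there are only finitely many others.\<close>

lemma well_ordered_by_locally_finite:
  assumes "A \<subseteq> S" "s0 \<in> S" "\<And>v. v \<in> A \<Longrightarrow> (s0, v) \<in> r"
    and "\<And>v. v \<in> A \<Longrightarrow> finite {u \<in> A. (u, v) \<in> r}"
  shows "well_ordered_by r A"
  unfolding well_ordered_by_def
proof (intro allI impI)
  fix V assume V: "V \<subseteq> A" "V \<noteq> {}"
  then obtain v where v: "v \<in> V" by blast
  let ?W = "{u \<in> V. (u, v) \<in> r}"
  have "?W \<subseteq> {u \<in> A. (u, v) \<in> r}" using V by blast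
  then have "finite ?W" using assms(4)[of v] v V finite_subset by blast
  moreover have "v \<in> ?W" using v V assms(1) le_refl by blast
  ultimately obtain l where l: "is_least r ?W l"
    using finite_has_least[of ?W] V assms(1) by blast
  have "(l, u) \<in> r" if "u \<in> V" for u
  proof (cases "(u, v) \<in> r")
    case True
    then show ?thesis using l that by (auto simp: is_least_def)
  next
    case False
    then have "(v, u) \<in> r" using le_cases that v V assms(1) by blast
    moreover have "(l, v) \<in> r" using l by (auto simp: is_least_def)
    ultimately show ?thesis using le_trans by blast
  qed
  then have "is_least r V l" using l by (auto simp: is_least_def)
  then show "\<exists>l. is_least r V l" by blast
qed

end

section \<open>The product metric\<close>

lemma mdist_self [simp]: "x \<in> mspace m \<Longrightarrow> mdist m x x = 0"
  by (simp add: mdist_zero)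

locale product_metric_space = linear_ordered_set S r
  for S :: "'s set" and r :: "'s rel" +
  fixes G :: "'s \<Rightarrow> 'a metric" and a :: "'s \<Rightarrow> 'a"
  assumes base: "a \<in> (\<Pi>\<^sub>E s\<in>S. mspace (G s))"
    and is_metric: "product_is_metric S r G a"
begin

abbreviation "Z \<equiv> product_space S r G a"
abbreviation "\<rho> \<equiv> product_dist S r G"
abbreviation "T \<equiv> supp S G"

sublocale H: Metric_space Z \<rho>
  using is_metric by (simp add: product_is_metric_def)

lemma T_sub: "T \<subseteq> S" by (auto simp: supp_def)

lemma Z_iff: "x \<in> Z \<longleftrightarrow> x \<in> (\<Pi>\<^sub>E s\<in>S. mspace (G s)) \<and> well_ordered_by r (Diff S x a)"
proof -
  have "Diff S x a \<subseteq> S" by (auto simp: Diff_def)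
  then show ?thesis
    by (simp add: product_space_def well_order_on_Restr_iff)
qed

lemma base_in_Z: "a \<in> Z"
  using base by (auto simp: Z_iff Diff_def well_ordered_by_def)

lemma Z_nth: "x \<in> Z \<Longrightarrow> s \<in> S \<Longrightarrow> x s \<in> mspace (G s)"
  by (auto simp: Z_iff)

lemma differ_in_T: "x \<in> Z \<Longrightarrow> y \<in> Z \<Longrightarrow> x s \<noteq> y s \<Longrightarrow> s \<in> T"
proof -
  assume *: "x \<in> Z" "y \<in> Z" "x s \<noteq> y s"
  then have "s \<in> S" unfolding Z_iff PiE_def extensional_def by (metis (mono_tags, lifting) Int_iff mem_Collect_eq)
  then show ?thesis using * Z_nth unfolding supp_def by blast
qed

text \<open>Both points differ from \<open>a\<close> on well-ordered sets only, and so they differ from each other on a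
  subset of the union of two well-ordered sets.\<close>

lemma first_difference:
  assumes "x \<in> Z" "y \<in> Z" "x t \<noteq> y t"
  obtains l where "l \<in> T" "(l, t) \<in> r" "x l \<noteq> y l" "\<And>s. x s \<noteq> y s \<Longrightarrow> (l, s) \<in> r"
    "\<rho> x y = mdist (G l) (x l) (y l)"
proof -
  have S: "s \<in> S" if "x s \<noteq> y s" for s
    using differ_in_T[OF assms(1,2) that] T_sub by blast
  have "well_ordered_by r (Diff S x a \<union> Diff S y a)"
    using assms by (intro well_ordered_by_Un) (auto simp: Z_iff Diff_def)
  moreover have "Diff S x y \<subseteq> Diff S x a \<union> Diff S y a" by (auto simp: Diff_def)
  moreover have "Diff S x y \<noteq> {}" using assms S by (auto simp: Diff_def)
  ultimately obtain l where l: "is_least r (Diff S x y) l"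
    unfolding well_ordered_by_def by blast
  then have the: "(THE l. is_least r (Diff S x y) l) = l"
    using least_unique by blast
  have "x \<noteq> y" using assms by auto
  then have "\<rho> x y = mdist (G l) (x l) (y l)"
    by (simp add: product_dist_def the)
  then show thesis
    using that[of l] l S assms differ_in_T by (auto simp: is_least_def Diff_def)
qed

lemma dist_eqI:
  assumes "x \<in> Z" "y \<in> Z" "x l \<noteq> y l" "\<And>s. x s \<noteq> y s \<Longrightarrow> (l, s) \<in> r"
  shows "\<rho> x y = mdist (G l) (x l) (y l)"
proof -
  obtain l' where "(l', l) \<in> r" "x l' \<noteq> y l'" "\<rho> x y = mdist (G l') (x l') (y l')"
    using first_difference[OF assms(1-3)] by metis
  moreover have "l' = l" using assms(4) calculation le_antisym by blast
  ultimately show ?thesis by simp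
qed

lemma update_in_Z:
  assumes "x \<in> Z" "s \<in> S" "u \<in> mspace (G s)"
  shows "x(s := u) \<in> Z"
proof -
  have "well_ordered_by r ({s} \<union> Diff S x a)"
    using assms well_ordered_by_finite[of "{s}"]
    by (intro well_ordered_by_Un) (auto simp: Z_iff Diff_def)
  moreover have "Diff S (x(s := u)) a \<subseteq> {s} \<union> Diff S x a" by (auto simp: Diff_def)
  ultimately have "well_ordered_by r (Diff S (x(s := u)) a)"
    by (rule well_ordered_by_subset)
  then show ?thesis using assms by (auto simp: Z_iff PiE_def extensional_def)
qed

lemma dist_update:
  assumes "x \<in> Z" "s \<in> S" "u \<in> mspace (G s)" "v \<in> mspace (G s)"
  shows "\<rho> (x(s := u)) (x(s := v)) = mdist (G s) u v"
proof (cases "u = v")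
  case True
  then show ?thesis using assms by (simp add: product_dist_def)
next
  case False
  have "\<rho> (x(s := u)) (x(s := v)) = mdist (G s) ((x(s := u)) s) ((x(s := v)) s)"
    by (rule dist_eqI) (use False update_in_Z assms le_refl in \<open>auto split: if_splits\<close>)
  then show ?thesis by simp
qed

text \<open>This is where the triangle inequality of the product enters.  For \<open>s < t\<close> the points with
  coordinates \<open>(x, u)\<close>, \<open>(y, u)\<close>, \<open>(x, v)\<close> in \<open>s, t\<close> form a triangle with one side in the
  factor \<open>t\<close> and two equal sides in the factor \<open>s\<close>.\<close>

lemma dist_later_le_twice_earlier:
  assumes "(s, t) \<in> r" "s \<noteq> t" and x: "x \<in> mspace (G s)" "y \<in> mspace (G s)" "x \<noteq> y"
    and u: "u \<in> mspace (G t)" "v \<in> mspace (G t)"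
  shows "mdist (G t) u v \<le> 2 * mdist (G s) x y"
proof -
  have S: "s \<in> S" "t \<in> S" using le_in[OF assms(1)] by blast+
  let ?P = "a(s := x, t := u)" and ?Q = "a(s := x, t := v)" and ?R = "a(s := y, t := u)"
  have Z: "?P \<in> Z" "?Q \<in> Z" "?R \<in> Z"
    using base_in_Z update_in_Z S x u by auto
  have "\<rho> ?P ?Q = mdist (G t) u v"
    by (rule dist_update) (use base_in_Z update_in_Z S x u in auto)
  moreover have "\<rho> ?P ?R = mdist (G s) (?P s) (?R s)"
    by (rule dist_eqI[OF Z(1,3)]) (use S assms(1,2,5) le_refl in \<open>auto split: if_splits\<close>)
  moreover have "\<rho> ?R ?Q = mdist (G s) (?R s) (?Q s)"
    by (rule dist_eqI[OF Z(3,2)]) (use S assms(1,2,5) le_refl in \<open>auto split: if_splits\<close>)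
  moreover have "\<rho> ?P ?Q \<le> \<rho> ?P ?R + \<rho> ?R ?Q"
    using H.triangle Z by blast
  ultimately show ?thesis using assms(2) by (simp add: mdist_commute)
qed

text \<open>In other words, coordinate projections are 2-Lipschitz: if the points first differ at
  an index before \<open>t\<close>, then \<open>dist_later_le_twice_earlier\<close> applies.\<close>

lemma coordinate_dist_le:
  assumes "x \<in> Z" "y \<in> Z" "t \<in> S"
  shows "mdist (G t) (x t) (y t) \<le> 2 * \<rho> x y"
proof (cases "x t = y t")
  case True
  then show ?thesis using Z_nth[OF assms(2,3)] product_dist_nonneg[of S r G x y] by simp
next
  case False
  then obtain l where l: "l \<in> T" "(l, t) \<in> r" "x l \<noteq> y l" "\<rho> x y = mdist (G l) (x l) (y l)"
    using first_difference[OF assms(1,2)] by metis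
  have lS: "l \<in> S" using l T_sub by blast
  show ?thesis
  proof (cases "l = t")
    case True
    then show ?thesis using l mdist_nonneg[of "G t" "x t" "y t"] by simp
  next
    case False
    then show ?thesis
      using dist_later_le_twice_earlier[OF l(2) False Z_nth[OF assms(1) lS] Z_nth[OF assms(2) lS]
          l(3) Z_nth[OF assms(1,3)] Z_nth[OF assms(2,3)]] l(4) by simp
  qed
qed

lemma T_two_points:
  assumes "s \<in> T"
  obtains x y where "x \<in> mspace (G s)" "y \<in> mspace (G s)" "x \<noteq> y" "0 < mdist (G s) x y"
proof -
  obtain x y where *: "x \<in> mspace (G s)" "y \<in> mspace (G s)" "x \<noteq> y"
    using assms by (auto simp: supp_def)
  then have "0 < mdist (G s) x y"
    using mdist_nonneg[of "G s" x y] mdist_zero[of x "G s" y] by linarith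
  then show thesis using that * by blast
qed

text \<open>Comparison with an earlier factor bounds the distances; in the next lemma, comparison with a
  later factor bounds the positive distances away from 0.\<close>

lemma not_least_bounded:
  assumes "t \<in> T" "\<not> is_least r T t"
  obtains e where "\<And>x y. x \<in> mspace (G t) \<Longrightarrow> y \<in> mspace (G t) \<Longrightarrow> mdist (G t) x y \<le> e"
proof -
  obtain s where s: "s \<in> T" "(t, s) \<notin> r"
    using assms by (auto simp: is_least_def)
  then have st: "(s, t) \<in> r" "s \<noteq> t"
    using le_cases[of s t] assms T_sub le_refl by auto
  obtain x y where "x \<in> mspace (G s)" "y \<in> mspace (G s)" "x \<noteq> y"
    using T_two_points[OF s(1)] .
  then show thesis
    using that dist_later_le_twice_earlier[OF st] by blast
qed

lemma not_greatest_uniformly_discrete: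
  assumes "s \<in> T" "\<not> is_greatest r T s"
  obtains e where "e > 0"
    "\<And>x y. x \<in> mspace (G s) \<Longrightarrow> y \<in> mspace (G s) \<Longrightarrow> x \<noteq> y \<Longrightarrow> e \<le> mdist (G s) x y"
proof -
  obtain t where t: "t \<in> T" "(t, s) \<notin> r"
    using assms by (auto simp: is_greatest_def)
  then have st: "(s, t) \<in> r" "s \<noteq> t"
    using le_cases[of s t] assms T_sub le_refl by auto
  obtain u v where "u \<in> mspace (G t)" "v \<in> mspace (G t)" "0 < mdist (G t) u v"
    using T_two_points[OF t(1)] .
  then show thesis
    using that[of "mdist (G t) u v / 2"] dist_later_le_twice_earlier[OF st _ _ _ \<open>u \<in> _\<close> \<open>v \<in> _\<close>]
    by fastforce
qed

lemma Heine_Borel_product_iff: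
  "Heine_Borel (product_metric S r G a) \<longleftrightarrow>
     (\<forall>x\<in>Z. \<forall>e. compactin H.mtopology (H.mcball x e))"
  by (simp add: Heine_Borel_def product_metric_def)

end

section \<open>Compactness and discreteness in metric spaces\<close>

lemma compact_imp_Heine_Borel:
  assumes "compact_space (mtopology_of m)"
  shows "Heine_Borel m"
proof -
  interpret M: Metric_space "mspace m" "mdist m" by simp
  have "compact_space M.mtopology" using assms by (simp add: mtopology_of_def)
  then have "compactin M.mtopology (M.mcball x e)" for x e
    using closedin_compact_space M.closedin_mcball by blast
  then show ?thesis by (simp add: Heine_Borel_def mtopology_of_def mcball_of_def)
qed

lemma Heine_Borel_bounded_iff_compact:
  assumes "\<And>x y. x \<in> mspace m \<Longrightarrow> y \<in> mspace m \<Longrightarrow> mdist m x y \<le> e"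
  shows "Heine_Borel m \<longleftrightarrow> compact_space (mtopology_of m)"
proof
  assume hb: "Heine_Borel m"
  show "compact_space (mtopology_of m)"
  proof (cases "mspace m = {}")
    case False
    then obtain x where x: "x \<in> mspace m" by blast
    then have "mcball_of m x e = mspace m" using assms by auto
    moreover have "compactin (mtopology_of m) (mcball_of m x e)"
      using hb x by (simp add: Heine_Borel_def)
    ultimately show ?thesis by (simp add: compact_space_def)
  qed (simp add: compact_space_def)
qed (rule compact_imp_Heine_Borel)

lemma finite_imp_compact_space_mtopology: "finite (mspace m) \<Longrightarrow> compact_space (mtopology_of m)"
  by (simp add: compact_space_def finite_imp_compactin)

lemma uniformly_discrete_topology:
  assumes "e > 0"
    "\<And>x y. x \<in> mspace m \<Longrightarrow> y \<in> mspace m \<Longrightarrow> x \<noteq> y \<Longrightarrow> e \<le> mdist m x y"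
  shows "topologically_discrete m"
proof -
  interpret M: Metric_space "mspace m" "mdist m" by simp
  have "openin M.mtopology {x}" if "x \<in> mspace m" for x
  proof -
    have "M.mball x e = {x}" using assms that by force
    then show ?thesis by (metis M.openin_mball)
  qed
  then show ?thesis
    using discrete_topology_unique[of "mspace m" M.mtopology]
    by (simp add: mtopology_of_def topologically_discrete_def)
qed

lemma (in Metric_space) compactin_uniformly_discrete_finite:
  assumes "compactin mtopology C" "P \<subseteq> C" "\<delta> > 0"
    "\<And>x y. x \<in> P \<Longrightarrow> y \<in> P \<Longrightarrow> x \<noteq> y \<Longrightarrow> \<delta> \<le> d x y"
  shows "finite P"
proof -
  have "mtotally_bounded P"
    using mtotally_bounded_subset[OF compactin_imp_mtotally_bounded[OF assms(1)] assms(2)] .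
  then obtain K where K: "finite K" "K \<subseteq> P" "P \<subseteq> (\<Union>x\<in>K. mball x \<delta>)"
    using assms(3) unfolding mtotally_bounded_def by meson
  have "P \<subseteq> K"
  proof
    fix p assume "p \<in> P"
    then obtain x where "x \<in> K" "d x p < \<delta>" using K by auto
    then have "x = p" using assms(4)[of x p] K \<open>p \<in> P\<close> by force
    then show "p \<in> K" using \<open>x \<in> K\<close> by simp
  qed
  then show ?thesis using K finite_subset by blast
qed

lemma discrete_compact_finite:
  assumes "topologically_discrete m" "compact_space (mtopology_of m)"
  shows "finite (mspace m)"
  using assms by (simp add: topologically_discrete_def compact_space_discrete_topology)

lemma homogeneous:
  assumes "absolutely_homogeneous m" "x \<in> mspace m" "y \<in> mspace m"
  obtains g where "g x = y" "\<And>u. u \<in> mspace m \<Longrightarrow> g u \<in> mspace m"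
    "\<And>u v. u \<in> mspace m \<Longrightarrow> v \<in> mspace m \<Longrightarrow> mdist m (g u) (g v) = mdist m u v"
proof -
  have "{x} \<subseteq> mspace m \<and> isometry_on m {x} (\<lambda>_. y)"
    using assms by (auto simp: isometry_on_def)
  then obtain g where "isometry_on m (mspace m) g" "\<forall>u\<in>{x}. g u = y"
    using assms(1) unfolding absolutely_homogeneous_def by blast
  then show thesis using that[of g] by (auto simp: isometry_on_def)
qed

section \<open>Necessary conditions for the product to be Heine-Borel\<close>

context product_metric_space
begin

text \<open>Changing the base point in one coordinate \<open>s\<close>, for \<open>s\<close> running through an infinite
  set of indices, gives an infinite uniformly discrete subset of a ball, if the
  changes stay bounded and bounded away from zero.\<close>

lemma finite_bounded_changes:
  assumes HB: "Heine_Borel (product_metric S r G a)"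
    and U: "U \<subseteq> S" "\<delta> > 0"
    and w: "\<And>s. s \<in> U \<Longrightarrow> w s \<in> mspace (G s)"
      "\<And>s. s \<in> U \<Longrightarrow> \<delta> \<le> mdist (G s) (a s) (w s)"
      "\<And>s. s \<in> U \<Longrightarrow> mdist (G s) (a s) (w s) \<le> e"
  shows "finite U"
proof -
  let ?p = "\<lambda>s. a(s := w s)"
  have ne: "a s \<noteq> w s" if "s \<in> U" for s
    using w(1,2)[OF that] U by auto
  have Z: "?p s \<in> Z" if "s \<in> U" for s
    using that w U base_in_Z update_in_Z by blast
  have inj: "inj_on ?p U"
    by (rule inj_onI) (metis fun_upd_apply ne)
  have sep: "\<delta> \<le> \<rho> (?p s) (?p t)" if "s \<in> U" "t \<in> U" "s \<noteq> t" for s t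
  proof -
    have *: "\<delta> \<le> \<rho> (?p s) (?p t)" if "s \<in> U" "t \<in> U" "s \<noteq> t" "(s, t) \<in> r" for s t
    proof -
      have "\<rho> (?p s) (?p t) = mdist (G s) (?p s s) (?p t s)"
        by (rule dist_eqI[OF Z Z]) (use that ne[OF that(1)] U le_refl in \<open>auto split: if_splits\<close>)
      then show ?thesis using w(2)[OF that(1)] that(3) by (simp add: mdist_commute)
    qed
    then show ?thesis
      using that le_cases[of s t] U product_dist_commute[of S r G] by (metis subsetD)
  qed
  have "?p ` U \<subseteq> H.mcball a e"
  proof clarsimp
    fix s assume s: "s \<in> U"
    have "\<rho> (a(s := a s)) (?p s) = mdist (G s) (a s) (w s)"
      by (rule dist_update) (use s w U base_in_Z Z_nth in auto)
    then show "a \<in> Z \<and> ?p s \<in> Z \<and> \<rho> a (?p s) \<le> e"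
      using s w Z base_in_Z by simp
  qed
  moreover have "compactin H.mtopology (H.mcball a e)"
    using HB base_in_Z by (simp add: Heine_Borel_product_iff)
  ultimately have "finite (?p ` U)"
    using H.compactin_uniformly_discrete_finite[OF _ _ U(2), of "H.mcball a e" "?p ` U"] sep by blast
  then show ?thesis using inj finite_imageD by blast
qed

text \<open>The ball about \<open>x\<close> in a factor is contained in the projection of the ball about the point
  with coordinate \<open>x\<close>, which is compact because projections are continuous.\<close>

lemma factors_Heine_Borel:
  assumes HB: "Heine_Borel (product_metric S r G a)" and s: "s \<in> S"
  shows "Heine_Borel (G s)"
  unfolding Heine_Borel_def
proof (intro ballI allI)
  fix x e assume x: "x \<in> mspace (G s)"
  interpret M: Metric_space "mspace (G s)" "mdist (G s)" by simp
  let ?x = "a(s := x)"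
  have Z: "?x \<in> Z" using x s base_in_Z update_in_Z by blast
  have cont: "continuous_map (mtopology_of (product_metric S r G a)) (mtopology_of (G s)) (\<lambda>z. z s)"
  proof (rule Lipschitz_continuous_imp_continuous_map)
    show "Lipschitz_continuous_map (product_metric S r G a) (G s) (\<lambda>z. z s)"
      unfolding Lipschitz_continuous_map_def product_metric_def
      using Z_nth s coordinate_dist_le by (auto intro!: exI[of _ 2])
  qed
  have "compactin H.mtopology (H.mcball ?x e)"
    using HB Z by (auto simp: Heine_Borel_product_iff)
  then have "compactin (mtopology_of (G s)) ((\<lambda>z. z s) ` H.mcball ?x e)"
    by (rule image_compactin) (use cont in \<open>simp add: product_metric_def\<close>)
  moreover have "mcball_of (G s) x e \<subseteq> (\<lambda>z. z s) ` H.mcball ?x e"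
  proof
    fix y assume y: "y \<in> mcball_of (G s) x e"
    then have "a(s := y) \<in> H.mcball ?x e"
      using Z dist_update[OF base_in_Z s] update_in_Z base_in_Z s by auto
    then have "(a(s := y)) s \<in> (\<lambda>z. z s) ` H.mcball ?x e" by (rule imageI)
    then show "y \<in> (\<lambda>z. z s) ` H.mcball ?x e" by simp
  qed
  ultimately show "compactin (mtopology_of (G s)) (mcball_of (G s) x e)"
    using closed_compactin by (metis M.closedin_mcball mcball_of_def mtopology_of_def)
qed

text \<open>Positive distances in the factors strictly between \<open>s\<close> and \<open>t\<close> are at most twice a positive
  distance in the factor \<open>s\<close>, and at least half a positive distance in the factor \<open>t\<close>.\<close>

lemma Heine_Borel_imp_locally_finite:
  assumes HB: "Heine_Borel (product_metric S r G a)" and st: "s \<in> T" "t \<in> T"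
  shows "finite {u \<in> T. (s, u) \<in> r \<and> (u, t) \<in> r}"
proof -
  let ?U = "{u \<in> T. (s, u) \<in> r \<and> (u, t) \<in> r \<and> u \<noteq> s \<and> u \<noteq> t}"
  obtain x y where xy: "x \<in> mspace (G s)" "y \<in> mspace (G s)" "x \<noteq> y"
    using T_two_points[OF st(1)] .
  obtain p q where pq: "p \<in> mspace (G t)" "q \<in> mspace (G t)" "0 < mdist (G t) p q"
    using T_two_points[OF st(2)] .
  have "\<exists>w\<in>mspace (G u). a u \<noteq> w" if "u \<in> T" for u
    using T_two_points[OF that] by metis
  then obtain w where w: "\<And>u. u \<in> T \<Longrightarrow> w u \<in> mspace (G u)" "\<And>u. u \<in> T \<Longrightarrow> a u \<noteq> w u"
    by metis
  have aT: "a u \<in> mspace (G u)" if "u \<in> T" for u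
    using that base_in_Z Z_nth T_sub by blast
  have "finite ?U"
  proof (rule finite_bounded_changes[OF HB, where w = w and \<delta> = "mdist (G t) p q / 2"
          and e = "2 * mdist (G s) x y"])
    fix u assume u: "u \<in> ?U"
    show "mdist (G t) p q / 2 \<le> mdist (G u) (a u) (w u)"
      using dist_later_le_twice_earlier[of u t "a u" "w u" p q] u w pq aT by auto
    show "mdist (G u) (a u) (w u) \<le> 2 * mdist (G s) x y"
      using dist_later_le_twice_earlier[of s u x y "a u" "w u"] u w xy aT by auto
  qed (use T_sub pq w in auto)
  then have "finite (?U \<union> {s, t})" by simp
  then show ?thesis by (rule rev_finite_subset) auto
qed

text \<open>If a factor has diameter at least \<open>\<epsilon>\<close>, then one of its points has distance at least
  \<open>\<epsilon> / 2\<close> from the base point.  Above a fixed index these distances are bounded, so that there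
  are finitely many such factors.\<close>

lemma Heine_Borel_imp_diameters_vanish:
  assumes HB: "Heine_Borel (product_metric S r G a)"
    and "T \<noteq> {}" "\<nexists>q. is_greatest r T q" "\<epsilon> > 0"
  shows "\<exists>s\<in>T. \<forall>t\<in>T. (s, t) \<in> r \<longrightarrow>
           (\<forall>x\<in>mspace (G t). \<forall>y\<in>mspace (G t). mdist (G t) x y < \<epsilon>)"
proof -
  obtain s where s: "s \<in> T" using assms by blast
  obtain x y where xy: "x \<in> mspace (G s)" "y \<in> mspace (G s)" "x \<noteq> y"
    using T_two_points[OF s] .
  let ?U = "{t \<in> T. (s, t) \<in> r \<and> t \<noteq> s \<and>
              (\<exists>x\<in>mspace (G t). \<exists>y\<in>mspace (G t). \<not> mdist (G t) x y < \<epsilon>)}"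
  have aT: "a u \<in> mspace (G u)" if "u \<in> T" for u
    using that base_in_Z Z_nth T_sub by blast
  have "\<exists>w\<in>mspace (G t). \<epsilon> / 2 \<le> mdist (G t) (a t) w" if t: "t \<in> ?U" for t
  proof -
    obtain x y where xy: "x \<in> mspace (G t)" "y \<in> mspace (G t)" "\<not> mdist (G t) x y < \<epsilon>"
      using t by blast
    have "mdist (G t) x y \<le> mdist (G t) (a t) x + mdist (G t) (a t) y"
      using mdist_triangle[of x "G t" "a t" y] xy t aT mdist_commute[of "G t" x "a t"] by auto
    then have "\<epsilon> / 2 \<le> mdist (G t) (a t) x \<or> \<epsilon> / 2 \<le> mdist (G t) (a t) y"
      using xy by linarith
    then show ?thesis using xy by blast
  qed
  then have "\<exists>w. \<forall>t\<in>?U. w t \<in> mspace (G t) \<and> \<epsilon> / 2 \<le> mdist (G t) (a t) (w t)"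
    by (intro bchoice) blast
  then obtain w where w: "\<And>t. t \<in> ?U \<Longrightarrow> w t \<in> mspace (G t)"
    "\<And>t. t \<in> ?U \<Longrightarrow> \<epsilon> / 2 \<le> mdist (G t) (a t) (w t)"
    by blast
  have "finite ?U"
  proof (rule finite_bounded_changes[OF HB, where w = w and \<delta> = "\<epsilon> / 2"
          and e = "2 * mdist (G s) x y"])
    fix u assume u: "u \<in> ?U"
    show "mdist (G u) (a u) (w u) \<le> 2 * mdist (G s) x y"
      using dist_later_le_twice_earlier[of s u x y "a u" "w u"] u w(1)[OF u] xy aT by auto
  qed (use T_sub w assms in auto)
  then obtain s1 where s1: "s1 \<in> T" "\<forall>u\<in>insert s ?U. (u, s1) \<in> r \<and> u \<noteq> s1"
    using strict_upper_bound[of "insert s ?U" T] assms T_sub s by auto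
  have "t \<notin> insert s ?U \<and> (s, t) \<in> r" if "(s1, t) \<in> r" for t
    using that s1(2) le_trans le_antisym by blast
  then show ?thesis using s1(1) by blast
qed

text \<open>A factor with two points at distance at most \<open>M\<close> has, by homogeneity, such a pair
  containing the base point.  Below a fixed index positive distances are bounded away
  from 0, so that there are finitely many such factors.\<close>

lemma Heine_Borel_imp_codiameters_infinite:
  assumes HB: "Heine_Borel (product_metric S r G a)"
    and AH: "\<And>s. s \<in> S \<Longrightarrow> absolutely_homogeneous (G s)"
    and "T \<noteq> {}" "\<nexists>p. is_least r T p"
  shows "\<exists>s\<in>T. \<forall>t\<in>T. (t, s) \<in> r \<longrightarrow>
           (\<forall>x\<in>mspace (G t). \<forall>y\<in>mspace (G t). x \<noteq> y \<longrightarrow> M < mdist (G t) x y)"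
proof -
  obtain s where s: "s \<in> T" using assms by blast
  obtain x y where xy: "x \<in> mspace (G s)" "y \<in> mspace (G s)" "0 < mdist (G s) x y"
    using T_two_points[OF s] .
  let ?U = "{t \<in> T. (t, s) \<in> r \<and> t \<noteq> s \<and>
              (\<exists>x\<in>mspace (G t). \<exists>y\<in>mspace (G t). x \<noteq> y \<and> \<not> M < mdist (G t) x y)}"
  have aT: "a u \<in> mspace (G u)" if "u \<in> T" for u
    using that base_in_Z Z_nth T_sub by blast
  have "\<exists>w\<in>mspace (G t). a t \<noteq> w \<and> mdist (G t) (a t) w \<le> M" if t: "t \<in> ?U" for t
  proof -
    obtain x y where xy: "x \<in> mspace (G t)" "y \<in> mspace (G t)" "x \<noteq> y" "\<not> M < mdist (G t) x y"
      using t by blast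
    have at: "a t \<in> mspace (G t)" using aT t by blast
    have "absolutely_homogeneous (G t)" using AH t T_sub by blast
    then obtain g where g: "g x = a t" "g y \<in> mspace (G t)"
      "mdist (G t) (g x) (g y) = mdist (G t) x y"
      using homogeneous[OF _ xy(1) at] xy by metis
    have "a t \<noteq> g y"
      using g xy mdist_zero[OF xy(1,2)] mdist_zero[OF at g(2)] by auto
    moreover have "mdist (G t) (a t) (g y) \<le> M" using g xy by simp
    ultimately show ?thesis using g(2) by blast
  qed
  then have "\<exists>w. \<forall>t\<in>?U. w t \<in> mspace (G t) \<and> a t \<noteq> w t \<and> mdist (G t) (a t) (w t) \<le> M"
    by (intro bchoice) blast
  then obtain w where w: "\<And>t. t \<in> ?U \<Longrightarrow> w t \<in> mspace (G t)"
    "\<And>t. t \<in> ?U \<Longrightarrow> a t \<noteq> w t" "\<And>t. t \<in> ?U \<Longrightarrow> mdist (G t) (a t) (w t) \<le> M"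
    by blast
  have "finite ?U"
  proof (rule finite_bounded_changes[OF HB, where w = w and \<delta> = "mdist (G s) x y / 2" and e = M])
    fix u assume u: "u \<in> ?U"
    show "mdist (G s) x y / 2 \<le> mdist (G u) (a u) (w u)"
      using dist_later_le_twice_earlier[of u s "a u" "w u" x y] u w(1,2)[OF u] xy aT by auto
  qed (use T_sub w xy in auto)
  then obtain s1 where s1: "s1 \<in> T" "\<forall>u\<in>insert s ?U. (s1, u) \<in> r \<and> u \<noteq> s1"
    using strict_lower_bound[of "insert s ?U" T] assms T_sub s by auto
  have "t \<notin> insert s ?U \<and> (t, s) \<in> r" if "(t, s1) \<in> r" for t
    using that s1(2) le_trans le_antisym by blast
  then show ?thesis using s1(1) by blast
qed

end

section \<open>Sufficient conditions for the product to be Heine-Borel\<close>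

context product_metric_space
begin

text \<open>A point of the full product which agrees with a point of \<open>Z\<close> below \<open>s0\<close> lies in \<open>Z\<close>,
  because the part of the support from \<open>s0\<close> on is well-ordered.\<close>

lemma in_Z_if_eventually_constant:
  assumes x: "x \<in> Z" and s0: "s0 \<in> S" and z: "z \<in> (\<Pi>\<^sub>E s\<in>S. mspace (G s))"
    and fin: "\<And>t. t \<in> T \<Longrightarrow> finite {u \<in> T. (s0, u) \<in> r \<and> (u, t) \<in> r}"
    and eq: "\<And>s. s \<in> S \<Longrightarrow> (s0, s) \<notin> r \<Longrightarrow> z s = x s"
  shows "z \<in> Z"
proof -
  let ?A = "{t \<in> T. (s0, t) \<in> r}"
  have "well_ordered_by r ?A"
    by (rule well_ordered_by_locally_finite[of _ s0])
      (use s0 T_sub fin in \<open>auto elim!: rev_finite_subset\<close>)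
  then have "well_ordered_by r (Diff S x a \<union> ?A)"
    using x T_sub by (intro well_ordered_by_Un) (auto simp: Z_iff Diff_def)
  moreover have "Diff S z a \<subseteq> Diff S x a \<union> ?A"
  proof
    fix s assume s: "s \<in> Diff S z a"
    then have "s \<in> T" using z base by (force simp: supp_def Diff_def)
    then show "s \<in> Diff S x a \<union> ?A" using s eq[of s] by (fastforce simp: Diff_def)
  qed
  ultimately show ?thesis using z well_ordered_by_subset by (auto simp: Z_iff)
qed

text \<open>A ball lies in a box of compact sets, and the identity from this box with the product
  topology to \<open>Z\<close> with the topology of \<open>\<rho>\<close> is continuous: given \<open>\<epsilon>\<close>, only finitely many
  coordinates can contribute a distance of \<open>\<epsilon>\<close> or more, and in all of them but a greatest one
  the topology is discrete.  So the box is compact for \<open>\<rho>\<close> as well.\<close>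

lemma locally_finite_imp_Heine_Borel:
  assumes HB: "\<And>s. s \<in> T \<Longrightarrow> Heine_Borel (G s)"
    and fin: "\<And>s t. s \<in> T \<Longrightarrow> t \<in> T \<Longrightarrow> finite {u \<in> T. (s, u) \<in> r \<and> (u, t) \<in> r}"
    and up: "\<And>\<epsilon>. T \<noteq> {} \<Longrightarrow> \<nexists>q. is_greatest r T q \<Longrightarrow> \<epsilon> > 0 \<Longrightarrow>
         \<exists>s\<in>T. \<forall>t\<in>T. (s, t) \<in> r \<longrightarrow>
           (\<forall>x\<in>mspace (G t). \<forall>y\<in>mspace (G t). mdist (G t) x y < \<epsilon>)"
    and down: "\<And>M. T \<noteq> {} \<Longrightarrow> \<nexists>p. is_least r T p \<Longrightarrow>
         \<exists>s\<in>T. \<forall>t\<in>T. (t, s) \<in> r \<longrightarrow>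
           (\<forall>x\<in>mspace (G t). \<forall>y\<in>mspace (G t). x \<noteq> y \<longrightarrow> M < mdist (G t) x y)"
  shows "Heine_Borel (product_metric S r G a)"
  unfolding Heine_Borel_product_iff
proof (intro ballI allI)
  fix x e assume x: "x \<in> Z"
  show "compactin H.mtopology (H.mcball x e)"
  proof (cases "T = {} \<or> e < 0")
    case True
    then have "finite (H.mcball x e)"
    proof
      assume "T = {}"
      then have "H.mcball x e \<subseteq> {x}" using differ_in_T by fastforce
      then show ?thesis using finite_subset by blast
    next
      assume "e < 0"
      then have "H.mcball x e = {}" using H.mcball_eq_empty by blast
      then show ?thesis by simp
    qed
    then show ?thesis
      using H.mcball_subset_mspace by (intro finite_imp_compactin) auto
  next
    case False
    then have T: "T \<noteq> {}" and e: "e \<ge> 0" by auto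
    \<comment> \<open>below \<open>s0\<close>, all points of the ball agree with its centre\<close>
    obtain s0 where s0: "s0 \<in> T"
      and agree: "\<And>y s. y \<in> H.mcball x e \<Longrightarrow> (s0, s) \<notin> r \<Longrightarrow> y s = x s"
    proof (cases "\<exists>p. is_least r T p")
      case True
      then obtain p where p: "p \<in> T" "\<And>t. t \<in> T \<Longrightarrow> (p, t) \<in> r" by (auto simp: is_least_def)
      have "y s = x s" if y: "y \<in> H.mcball x e" and ps: "(p, s) \<notin> r" for y s
        using differ_in_T[of y x s] p(2)[of s] y ps x by auto
      then show thesis using p(1) that by blast
    next
      case False
      obtain p where p: "p \<in> T" "\<And>t x y. t \<in> T \<Longrightarrow> (t, p) \<in> r \<Longrightarrow> x \<in> mspace (G t) \<Longrightarrow>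
        y \<in> mspace (G t) \<Longrightarrow> x \<noteq> y \<Longrightarrow> e < mdist (G t) x y"
        using down[OF T False, of e] by metis
      have "y s = x s" if y: "y \<in> H.mcball x e" and ps: "(p, s) \<notin> r" for y s
      proof (rule ccontr)
        assume "y s \<noteq> x s"
        then have ne: "x s \<noteq> y s" by simp
        have yZ: "y \<in> Z" using y by simp
        obtain l where l: "l \<in> T" "(l, s) \<in> r" "x l \<noteq> y l" "\<rho> x y = mdist (G l) (x l) (y l)"
          using first_difference[OF x yZ ne] by metis
        have lp: "(l, p) \<in> r"
          using le_cases[of p l] p(1) l(1) le_trans[OF _ l(2), of p] T_sub ps by blast
        have "e < mdist (G l) (x l) (y l)"
          by (rule p(2)) (use l lp x yZ Z_nth T_sub in auto)
        then show False using l y by simp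
      qed
      then show thesis using that p by blast
    qed
    have s0S: "s0 \<in> S" using s0 T_sub by blast
    \<comment> \<open>the box of compact sets; above \<open>s0\<close> the factors are bounded, hence compact\<close>
    define K where "K s = (if s = s0 then mcball_of (G s) (x s) e
      else if (s0, s) \<in> r then mspace (G s) else {x s})" for s
    have Ksub: "K s \<subseteq> mspace (G s)" if "s \<in> S" for s
      using that x Z_nth by (auto simp: K_def)
    have compK: "compactin (mtopology_of (G s)) (K s)" if s: "s \<in> S" for s
    proof -
      consider "s = s0" | "s \<noteq> s0" "(s0, s) \<in> r" "s \<in> T" | "(s0, s) \<notin> r" | "s \<notin> T" by blast
      then show ?thesis
      proof cases
        case 1
        then show ?thesis using HB[OF s0] x Z_nth s by (auto simp: K_def Heine_Borel_def)
      next
        case 2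
        then have "\<not> is_least r T s" using s0 le_antisym by (auto simp: is_least_def)
        then obtain c where "\<And>u v. u \<in> mspace (G s) \<Longrightarrow> v \<in> mspace (G s) \<Longrightarrow> mdist (G s) u v \<le> c"
          using not_least_bounded 2 by metis
        then have "compact_space (mtopology_of (G s))"
          using Heine_Borel_bounded_iff_compact[of "G s" c] HB[OF 2(3)] by blast
        then show ?thesis using 2 by (simp add: K_def compact_space_def)
      next
        case 3
        then show ?thesis using s x Z_nth le_refl by (auto simp: K_def finite_imp_compactin)
      next
        case 4
        then have "K s \<subseteq> {x s}" using Ksub[OF s] s x Z_nth unfolding supp_def by blast
        then have "finite (K s)" using finite_subset by blast
        then show ?thesis using Ksub[OF s] by (simp add: finite_imp_compactin)
      qed
    qed
    have ball_K: "H.mcball x e \<subseteq> Pi\<^sub>E S K"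
    proof
      fix y assume y: "y \<in> H.mcball x e"
      then have yZ: "y \<in> Z" by simp
      have "y s \<in> K s" if s: "s \<in> S" for s
      proof (cases "s = s0")
        case True
        have "mdist (G s0) (x s0) (y s0) \<le> e"
        proof (cases "x s0 = y s0")
          case True
          then show ?thesis using e Z_nth[OF yZ s0S] by simp
        next
          case False
          have "\<rho> x y = mdist (G s0) (x s0) (y s0)"
            by (rule dist_eqI[OF x yZ False]) (use agree[OF y] in metis)
          then show ?thesis using y by simp
        qed
        then show ?thesis using True x yZ Z_nth s by (auto simp: K_def)
      next
        case False
        then show ?thesis using agree[OF y, of s] yZ Z_nth s by (auto simp: K_def)
      qed
      then show "y \<in> Pi\<^sub>E S K" using yZ by (auto simp: Z_iff PiE_def extensional_def)
    qed
    have K_Z: "Pi\<^sub>E S K \<subseteq> Z"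
    proof
      fix z assume z: "z \<in> Pi\<^sub>E S K"
      show "z \<in> Z"
      proof (rule in_Z_if_eventually_constant[OF x s0S])
        show "z \<in> (\<Pi>\<^sub>E s\<in>S. mspace (G s))"
          using z Ksub by (auto simp: PiE_def Pi_def)
        show "z s = x s" if "s \<in> S" "(s0, s) \<notin> r" for s
          using z that le_refl by (auto simp: K_def PiE_def Pi_def split: if_splits)
      qed (use fin s0 in auto)
    qed
    let ?X = "product_topology (\<lambda>s. mtopology_of (G s)) S"
    have cont: "continuous_map (subtopology ?X (Pi\<^sub>E S K)) H.mtopology (\<lambda>z. z)"
      unfolding H.continuous_map_to_metric
    proof (intro ballI allI impI)
      fix y and \<epsilon> :: real
      assume "y \<in> topspace (subtopology ?X (Pi\<^sub>E S K))" and \<epsilon>: "\<epsilon> > 0"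
      then have yK: "y \<in> Pi\<^sub>E S K" by simp
      then have yZ: "y \<in> Z" using K_Z by blast
      \<comment> \<open>after \<open>s1\<close>, differences are smaller than \<open>\<epsilon>\<close>\<close>
      obtain s1 where s1: "s1 \<in> T" and beyond: "\<And>t u v. t \<in> T \<Longrightarrow> (t, s1) \<notin> r \<Longrightarrow>
          u \<in> mspace (G t) \<Longrightarrow> v \<in> mspace (G t) \<Longrightarrow> mdist (G t) u v < \<epsilon>"
      proof (cases "\<exists>q. is_greatest r T q")
        case True
        then show thesis using that unfolding is_greatest_def by blast
      next
        case False
        then obtain q where "q \<in> T" "\<forall>t\<in>T. (q, t) \<in> r \<longrightarrow>
           (\<forall>x\<in>mspace (G t). \<forall>y\<in>mspace (G t). mdist (G t) x y < \<epsilon>)"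
          using up[OF T _ \<epsilon>] by blast
        then show thesis using that[of q] le_cases T_sub by blast
      qed
      define F where "F = {s \<in> T. (s0, s) \<in> r \<and> (s, s1) \<in> r}"
      have finF: "finite F" unfolding F_def using fin s0 s1 by blast
      \<comment> \<open>a cylinder about \<open>y\<close>: all factors but a greatest one have open points\<close>
      define U where "U s = (if s \<in> F then
          if is_greatest r T s then mball_of (G s) (y s) \<epsilon> else {y s} else mspace (G s))" for s
      have "openin ?X (Pi\<^sub>E S U)"
        unfolding openin_PiE_gen
      proof (intro disjI2 conjI ballI)
        show "finite {i \<in> S. U i \<noteq> topspace (mtopology_of (G i))}"
          by (rule finite_subset[OF _ finF]) (auto simp: U_def)
        show "openin (mtopology_of (G s)) (U s)" if s: "s \<in> S" for s
        proof -
          interpret M: Metric_space "mspace (G s)" "mdist (G s)" by simp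
          have ys: "y s \<in> mspace (G s)" using yZ Z_nth s by blast
          show ?thesis
          proof (cases "s \<in> F \<and> \<not> is_greatest r T s")
            case True
            then obtain c where "c > 0" "\<And>u v. u \<in> mspace (G s) \<Longrightarrow> v \<in> mspace (G s) \<Longrightarrow>
                u \<noteq> v \<Longrightarrow> c \<le> mdist (G s) u v"
              using not_greatest_uniformly_discrete[of s] unfolding F_def by blast
            then have "topologically_discrete (G s)" by (rule uniformly_discrete_topology)
            then show ?thesis
              using True ys by (simp add: topologically_discrete_def U_def)
          next
            case False
            then show ?thesis
              by (auto simp: U_def mball_of_def mtopology_of_def)
          qed
        qed
      qed
      then have op: "openin (subtopology ?X (Pi\<^sub>E S K)) (Pi\<^sub>E S U \<inter> Pi\<^sub>E S K)"
        by (auto simp: openin_subtopology)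
      have "y s \<in> U s" if "s \<in> S" for s
        using Z_nth[OF yZ that] \<epsilon> by (simp add: U_def)
      then have yU: "y \<in> Pi\<^sub>E S U"
        using yK by (auto simp: PiE_def)
      have "z \<in> H.mball y \<epsilon>" if z: "z \<in> Pi\<^sub>E S U \<inter> Pi\<^sub>E S K" for z
      proof -
        have zZ: "z \<in> Z" using z K_Z by blast
        have "\<rho> y z < \<epsilon>"
        proof (cases "y = z")
          case True
          then show ?thesis using \<epsilon> zZ by simp
        next
          case False
          then obtain t where "y t \<noteq> z t" by auto
          then obtain l where l: "l \<in> T" "y l \<noteq> z l" "\<rho> y z = mdist (G l) (y l) (z l)"
            using first_difference[OF yZ zZ] by metis
          have lS: "l \<in> S" using l T_sub by blast
          have "y l \<in> K l" "z l \<in> K l" using yK z lS by auto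
          then have s0l: "(s0, l) \<in> r" using l(2) s0S le_refl by (auto simp: K_def split: if_splits)
          have zU: "z l \<in> U l" using z lS by auto
          show ?thesis
          proof (cases "l \<in> F")
            case True
            then show ?thesis using zU l by (auto simp: U_def split: if_splits)
          next
            case False
            then have "(l, s1) \<notin> r" using l s0l by (auto simp: F_def)
            then show ?thesis using beyond l yZ zZ lS Z_nth by auto
          qed
        qed
        then show ?thesis using yZ zZ by simp
      qed
      then show "\<exists>U. openin (subtopology ?X (Pi\<^sub>E S K)) U \<and> y \<in> U \<and> (\<forall>z\<in>U. z \<in> H.mball y \<epsilon>)"
        using op yU yK by blast
    qed
    have "compactin ?X (Pi\<^sub>E S K)"
      using compK by (auto simp: compactin_PiE)
    then have "compactin (subtopology ?X (Pi\<^sub>E S K)) (Pi\<^sub>E S K)"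
      by (simp add: compactin_subtopology)
    then have "compactin H.mtopology ((\<lambda>z. z) ` Pi\<^sub>E S K)"
      using cont by (rule image_compactin)
    then have "compactin H.mtopology (Pi\<^sub>E S K)" by simp
    then show ?thesis using ball_K closed_compactin by blast
  qed
qed

end

section \<open>Locally finite linear orders\<close>

definition locally_finite :: "'s rel \<Rightarrow> 's set \<Rightarrow> bool" where
  "locally_finite r T \<longleftrightarrow> (\<forall>s\<in>T. \<forall>t\<in>T. finite {u \<in> T. (s, u) \<in> r \<and> (u, t) \<in> r})"

context linear_ordered_set
begin

text \<open>The embedding counts the elements between a fixed \<open>s0\<close> and \<open>t\<close>, with a negative sign if \<open>t\<close>
  precedes \<open>s0\<close>.  Its image is convex since the interval from \<open>s\<close> to \<open>t\<close> and its
  image have as many elements as the interval from \<open>f s\<close> to \<open>f t\<close>.\<close>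

lemma embedding_into_int:
  assumes T: "T \<subseteq> S" and lf: "locally_finite r T"
  obtains f :: "'s \<Rightarrow> int"
  where "\<And>s t. s \<in> T \<Longrightarrow> t \<in> T \<Longrightarrow> (s, t) \<in> r \<longleftrightarrow> f s \<le> f t"
    and "\<And>s t k. s \<in> T \<Longrightarrow> t \<in> T \<Longrightarrow> f s \<le> k \<Longrightarrow> k \<le> f t \<Longrightarrow> k \<in> f ` T"
proof (cases "T = {}")
  case True
  then show thesis using that[of "\<lambda>_. 0"] by simp
next
  case False
  then obtain s0 where s0: "s0 \<in> T" by blast
  define I where "I s t = {u \<in> T. (s, u) \<in> r \<and> u \<noteq> s \<and> (u, t) \<in> r}" for s t
  define f where "f t = int (card (I s0 t)) - int (card (I t s0))" for t
  have finI: "finite (I s t)" if "s \<in> T" "t \<in> T" for s t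
  proof -
    have "finite {u \<in> T. (s, u) \<in> r \<and> (u, t) \<in> r}" using lf that by (simp add: locally_finite_def)
    then show ?thesis by (rule rev_finite_subset) (auto simp: I_def)
  qed
  have I_empty: "I t s = {}" if "(s, t) \<in> r" for s t
    using that le_trans le_antisym unfolding I_def by blast
  have add: "card (I s u) = card (I s t) + card (I t u)"
    if "(s, t) \<in> r" "(t, u) \<in> r" "s \<in> T" "t \<in> T" "u \<in> T" for s t u
  proof -
    have "v \<in> I s t \<union> I t u" if v: "v \<in> I s u" for v
    proof (cases "(v, t) \<in> r")
      case True
      then show ?thesis using v by (simp add: I_def)
    next
      case False
      then have "(t, v) \<in> r" "v \<noteq> t"
        using le_cases[of v t] le_refl v T \<open>t \<in> T\<close> by (auto simp: I_def)
      then show ?thesis using v by (simp add: I_def)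
    qed
    moreover have "I s t \<subseteq> I s u"
      using le_trans[OF _ \<open>(t, u) \<in> r\<close>] by (auto simp: I_def)
    moreover have "v \<in> I s u" if v: "v \<in> I t u" for v
    proof -
      have "(s, v) \<in> r" using le_trans[OF \<open>(s, t) \<in> r\<close>] v by (auto simp: I_def)
      moreover have "v \<noteq> s" using le_antisym[OF \<open>(s, t) \<in> r\<close>] v by (auto simp: I_def)
      ultimately show ?thesis using v by (simp add: I_def)
    qed
    ultimately have "I s u = I s t \<union> I t u" by blast
    moreover have "I s t \<inter> I t u = {}" using le_antisym by (fastforce simp: I_def)
    ultimately show ?thesis using finI that by (simp add: card_Un_disjoint)
  qed
  have diff: "f t - f s = int (card (I s t))" if st: "(s, t) \<in> r" "s \<in> T" "t \<in> T" for s t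
  proof -
    have "(s0, s) \<in> r \<or> (s, s0) \<in> r \<and> (s0, t) \<in> r \<or> (t, s0) \<in> r"
      using le_cases[of s0 s] le_cases[of s0 t] T s0 st by blast
    then consider "(s0, s) \<in> r" | "(s, s0) \<in> r" "(s0, t) \<in> r" | "(t, s0) \<in> r" by blast
    then show ?thesis
    proof cases
      case 1
      then have "(s0, t) \<in> r" using st le_trans by blast
      then show ?thesis using add[OF 1 st(1) s0 st(2,3)] I_empty 1 by (simp add: f_def)
    next
      case 2
      then show ?thesis using add[OF 2 st(2) s0 st(3)] I_empty by (simp add: f_def)
    next
      case 3
      then have "(s, s0) \<in> r" using st le_trans by blast
      then show ?thesis using add[OF st(1) 3 st(2,3) s0] I_empty 3 by (simp add: f_def)
    qed
  qed
  have le: "(s, t) \<in> r \<longleftrightarrow> f s \<le> f t" if "s \<in> T" "t \<in> T" for s t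
  proof (cases "(s, t) \<in> r")
    case True
    then show ?thesis using diff[OF True that] by simp
  next
    case False
    then have ts: "(t, s) \<in> r" "s \<noteq> t" using le_cases[of s t] le_refl that T by auto
    then have "s \<in> I t s" using that le_refl T by (auto simp: I_def)
    then have "card (I t s) > 0" using finI[OF that(2,1)] by (auto simp: card_gt_0_iff)
    then show ?thesis using diff[OF ts(1) that(2,1)] False by simp
  qed
  have inj: "inj_on f T"
    by (rule inj_onI) (metis le le_antisym order_refl)
  have "k \<in> f ` T" if "s \<in> T" "t \<in> T" "f s \<le> k" "k \<le> f t" for s t k
  proof -
    have st: "(s, t) \<in> r" using le that by simp
    let ?J = "insert s (I s t)"
    have J: "?J \<subseteq> T" "finite ?J" using that finI by (auto simp: I_def)
    have "card (f ` ?J) = card ?J" using J inj by (intro card_image) (rule inj_on_subset)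
    also have "\<dots> = Suc (card (I s t))" using that finI by (simp add: I_def)
    also have "\<dots> = card {f s..f t}" using diff[OF st that(1,2)] by simp
    finally have "card (f ` ?J) = card {f s..f t}" .
    moreover have "f ` ?J \<subseteq> {f s..f t}"
      using le that st by (auto simp: I_def)
    ultimately have "f ` ?J = {f s..f t}"
      by (intro card_subset_eq) auto
    then have "k \<in> f ` ?J" using that by simp
    then show ?thesis using J by blast
  qed
  then show thesis using that le by blast
qed

lemma embedding_unbounded_above:
  fixes f :: "'s \<Rightarrow> int"
  assumes T: "T \<subseteq> S" "T \<noteq> {}" and q: "\<nexists>q. is_greatest r T q"
    and f: "\<And>s t. s \<in> T \<Longrightarrow> t \<in> T \<Longrightarrow> (s, t) \<in> r \<longleftrightarrow> f s \<le> f t"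
  shows "\<exists>t\<in>T. k \<le> f t"
proof -
  obtain t0 where t0: "t0 \<in> T" using T by blast
  have "\<exists>t\<in>T. f t0 + int n \<le> f t" for n
  proof (induction n)
    case (Suc n)
    then obtain t where t: "t \<in> T" "f t0 + int n \<le> f t" by blast
    then obtain t' where "t' \<in> T" "(t', t) \<notin> r"
      using q unfolding is_greatest_def by blast
    then show ?case using f[of t' t] t by (intro bexI[of _ t']) auto
  qed (use t0 in auto)
  from this[of "nat (k - f t0)"] obtain t where "t \<in> T" "f t0 + int (nat (k - f t0)) \<le> f t" by blast
  then show ?thesis by (intro bexI[of _ t]) linarith+
qed

lemma embedding_unbounded_below:
  fixes f :: "'s \<Rightarrow> int"
  assumes T: "T \<subseteq> S" "T \<noteq> {}" and p: "\<nexists>p. is_least r T p"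
    and f: "\<And>s t. s \<in> T \<Longrightarrow> t \<in> T \<Longrightarrow> (s, t) \<in> r \<longleftrightarrow> f s \<le> f t"
  shows "\<exists>t\<in>T. f t \<le> k"
proof -
  have "\<exists>t\<in>T. - k \<le> - f t"
  proof (rule linear_ordered_set.embedding_unbounded_above[OF converse T])
    show "\<nexists>q. is_greatest (r\<inverse>) T q" using p by (simp add: is_least_def is_greatest_def)
  qed (use f in auto)
  then show ?thesis by simp
qed

lemma embedding_inj:
  assumes T: "T \<subseteq> S"
    and f: "\<And>s t. s \<in> T \<Longrightarrow> t \<in> T \<Longrightarrow> (s, t) \<in> r \<longleftrightarrow> f s \<le> (f t :: 'b :: linorder)"
  shows "inj_on f T"
  by (rule inj_onI) (metis f le_antisym order_refl)

lemma order_isomorphic_nat_if: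
  assumes T: "T \<subseteq> S" and lf: "locally_finite r T"
    and p: "is_least r T p" and q: "\<nexists>q. is_greatest r T q"
  shows "order_isomorphic_to r T (UNIV :: nat set)"
proof -
  obtain f :: "'s \<Rightarrow> int" where f: "\<And>s t. s \<in> T \<Longrightarrow> t \<in> T \<Longrightarrow> (s, t) \<in> r \<longleftrightarrow> f s \<le> f t"
    and conv: "\<And>s t k. s \<in> T \<Longrightarrow> t \<in> T \<Longrightarrow> f s \<le> k \<Longrightarrow> k \<le> f t \<Longrightarrow> k \<in> f ` T"
    using embedding_into_int[OF T lf] by blast
  have least: "f p \<le> f t" if "t \<in> T" for t
    using p that f by (auto simp: is_least_def)
  let ?g = "\<lambda>t. nat (f t - f p)"
  have pT: "p \<in> T" using p by (simp add: is_least_def)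
  have g: "(s, t) \<in> r \<longleftrightarrow> ?g s \<le> ?g t" if "s \<in> T" "t \<in> T" for s t
    using f[OF that] least[OF that(1)] least[OF that(2)] by auto
  have "n \<in> ?g ` T" for n
  proof -
    obtain t where t: "t \<in> T" "f p + int n \<le> f t"
      using embedding_unbounded_above[OF T _ q f] pT by blast
    then have "f p + int n \<in> f ` T" using conv[OF pT t(1)] by simp
    then obtain u where "u \<in> T" "f u = f p + int n" by auto
    then show ?thesis by (intro image_eqI[of _ _ u]) auto
  qed
  then have "bij_betw ?g T UNIV"
    using embedding_inj[OF T g] by (auto simp: bij_betw_def)
  then show ?thesis using g unfolding order_isomorphic_to_def by blast
qed

lemma order_isomorphic_negative_int_if:
  assumes T: "T \<subseteq> S" and lf: "locally_finite r T"
    and p: "\<nexists>p. is_least r T p" and q: "is_greatest r T q"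
  shows "order_isomorphic_to r T {i :: int. i < 0}"
proof -
  obtain f :: "'s \<Rightarrow> int" where f: "\<And>s t. s \<in> T \<Longrightarrow> t \<in> T \<Longrightarrow> (s, t) \<in> r \<longleftrightarrow> f s \<le> f t"
    and conv: "\<And>s t k. s \<in> T \<Longrightarrow> t \<in> T \<Longrightarrow> f s \<le> k \<Longrightarrow> k \<le> f t \<Longrightarrow> k \<in> f ` T"
    using embedding_into_int[OF T lf] by blast
  have greatest: "f t \<le> f q" if "t \<in> T" for t
    using q that f by (auto simp: is_greatest_def)
  let ?g = "\<lambda>t. f t - f q - 1"
  have qT: "q \<in> T" using q by (simp add: is_greatest_def)
  have g: "(s, t) \<in> r \<longleftrightarrow> ?g s \<le> ?g t" if "s \<in> T" "t \<in> T" for s t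
    using f[OF that] by auto
  have "i \<in> ?g ` T" if "i < 0" for i
  proof -
    obtain t where t: "t \<in> T" "f t \<le> f q + 1 + i"
      using embedding_unbounded_below[OF T _ p f] qT by blast
    then have "f q + 1 + i \<in> f ` T" using conv[OF t(1) qT] that by simp
    then obtain u where "u \<in> T" "f u = f q + 1 + i" by auto
    then show ?thesis by (intro image_eqI[of _ _ u]) auto
  qed
  moreover have "?g t < 0" if "t \<in> T" for t using greatest[OF that] by simp
  ultimately have "bij_betw ?g T {i. i < 0}"
    using embedding_inj[OF T g] unfolding bij_betw_def by blast
  then show ?thesis using g unfolding order_isomorphic_to_def by blast
qed

lemma order_isomorphic_int_if:
  assumes T: "T \<subseteq> S" "T \<noteq> {}" and lf: "locally_finite r T"
    and p: "\<nexists>p. is_least r T p" and q: "\<nexists>q. is_greatest r T q"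
  shows "order_isomorphic_to r T (UNIV :: int set)"
proof -
  obtain f :: "'s \<Rightarrow> int" where f: "\<And>s t. s \<in> T \<Longrightarrow> t \<in> T \<Longrightarrow> (s, t) \<in> r \<longleftrightarrow> f s \<le> f t"
    and conv: "\<And>s t k. s \<in> T \<Longrightarrow> t \<in> T \<Longrightarrow> f s \<le> k \<Longrightarrow> k \<le> f t \<Longrightarrow> k \<in> f ` T"
    using embedding_into_int[OF T(1) lf] by blast
  have "i \<in> f ` T" for i
    using embedding_unbounded_below[OF T p f, of i] embedding_unbounded_above[OF T q f, of i] conv
    by blast
  then have "bij_betw f T UNIV"
    using embedding_inj[OF T(1) f] by (auto simp: bij_betw_def)
  then show ?thesis using f unfolding order_isomorphic_to_def by blast
qed

end

lemma order_isomorphic_locally_finite: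
  fixes B :: "'b :: linorder set"
  assumes "order_isomorphic_to r T B" "\<And>i j. i \<in> B \<Longrightarrow> j \<in> B \<Longrightarrow> finite {i..j}"
  shows "locally_finite r T"
  unfolding locally_finite_def
proof (intro ballI)
  fix s t assume st: "s \<in> T" "t \<in> T"
  obtain f where f: "bij_betw f T B" "\<forall>s\<in>T. \<forall>t\<in>T. (s, t) \<in> r \<longleftrightarrow> f s \<le> f t"
    using assms(1) unfolding order_isomorphic_to_def by blast
  let ?U = "{u \<in> T. (s, u) \<in> r \<and> (u, t) \<in> r}"
  have "f ` ?U \<subseteq> {f s..f t}" using f(2) st by auto
  moreover have "finite {f s..f t}" using f(1) st assms(2) by (auto simp: bij_betw_def)
  ultimately have "finite (f ` ?U)" by (rule finite_subset)
  moreover have "inj_on f ?U"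
    using f(1) by (auto simp: bij_betw_def inj_on_def)
  ultimately show "finite ?U" by (rule finite_imageD)
qed

lemma order_isomorphic_no_greatest:
  fixes B :: "'b :: linorder set"
  assumes "order_isomorphic_to r T B" "\<And>b. b \<in> B \<Longrightarrow> \<exists>c\<in>B. b < c"
  shows "\<nexists>q. is_greatest r T q"
proof
  assume "\<exists>q. is_greatest r T q"
  then obtain q where q: "q \<in> T" "\<And>t. t \<in> T \<Longrightarrow> (t, q) \<in> r" by (auto simp: is_greatest_def)
  obtain f where f: "bij_betw f T B" "\<forall>s\<in>T. \<forall>t\<in>T. (s, t) \<in> r \<longleftrightarrow> f s \<le> f t"
    using assms(1) unfolding order_isomorphic_to_def by blast
  have "f q \<in> B" using f(1) q(1) by (auto simp: bij_betw_def)
  then obtain c where "c \<in> B" "f q < c" using assms(2) by blast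
  then obtain t where "t \<in> T" "f q < f t" using f(1) by (auto simp: bij_betw_def)
  then show False using f(2) q by fastforce
qed

lemma order_isomorphic_no_least:
  fixes B :: "'b :: linorder set"
  assumes "order_isomorphic_to r T B" "\<And>b. b \<in> B \<Longrightarrow> \<exists>c\<in>B. c < b"
  shows "\<nexists>q. is_least r T q"
proof
  assume "\<exists>q. is_least r T q"
  then obtain q where q: "q \<in> T" "\<And>t. t \<in> T \<Longrightarrow> (q, t) \<in> r" by (auto simp: is_least_def)
  obtain f where f: "bij_betw f T B" "\<forall>s\<in>T. \<forall>t\<in>T. (s, t) \<in> r \<longleftrightarrow> f s \<le> f t"
    using assms(1) unfolding order_isomorphic_to_def by blast
  have "f q \<in> B" using f(1) q(1) by (auto simp: bij_betw_def)
  then obtain c where "c \<in> B" "c < f q" using assms(2) by blast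
  then obtain t where "t \<in> T" "f t < f q" using f(1) by (auto simp: bij_betw_def)
  then show False using f(2) q by fastforce
qed

section \<open>Limits of diameters and co-diameters\<close>

lemma diam_less_iff:
  assumes fin: "finite (mspace m)" and x: "x \<in> mspace m"
  shows "diam m < e \<longleftrightarrow> (\<forall>x\<in>mspace m. \<forall>y\<in>mspace m. mdist m x y < e)"
proof -
  let ?D = "{mdist m x y | x y. x \<in> mspace m \<and> y \<in> mspace m}"
  have "?D = (\<lambda>(x, y). mdist m x y) ` (mspace m \<times> mspace m)" by auto
  then have "finite ?D" using fin by simp
  moreover have "?D \<noteq> {}" using x by blast
  ultimately have "diam m < e \<longleftrightarrow> (\<forall>d\<in>?D. d < e)"
    by (simp add: diam_def cSup_eq_Max)
  then show ?thesis by blast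
qed

lemma diam_nonneg:
  assumes "finite (mspace m)" "x \<in> mspace m"
  shows "0 \<le> diam m"
  using diam_less_iff[OF assms, of 0] assms(2) mdist_nonneg[of m x x] by (meson not_le)

lemma less_codiam_iff:
  assumes fin: "finite (mspace m)" and x: "x \<in> mspace m" "y \<in> mspace m" "x \<noteq> y"
  shows "e < codiam m \<longleftrightarrow> (\<forall>x\<in>mspace m. \<forall>y\<in>mspace m. x \<noteq> y \<longrightarrow> e < mdist m x y)"
proof -
  have "positive_distances m \<subseteq> (\<lambda>(x, y). mdist m x y) ` (mspace m \<times> mspace m)"
    by (auto simp: positive_distances_def)
  then have "finite (positive_distances m)" using fin by (meson finite_SigmaI finite_imageI finite_subset)
  moreover have "positive_distances m \<noteq> {}" using x by (auto simp: positive_distances_def)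
  ultimately have "e < codiam m \<longleftrightarrow> (\<forall>d\<in>positive_distances m. e < d)"
    by (simp add: codiam_def)
  then show ?thesis unfolding positive_distances_def by blast
qed

context product_metric_space
begin

text \<open>Sufficiently late factors are finite, so that their diameters are maxima of distances.  In the
  next lemma, co-diameters of sufficiently early factors are minima in the same way.\<close>

lemma diameters_vanish_iff:
  assumes q: "\<nexists>q. is_greatest r T q" and T: "T \<noteq> {}"
    and fin: "\<And>s. s \<in> T \<Longrightarrow> \<not> is_least r T s \<Longrightarrow> finite (mspace (G s))"
  shows "((\<lambda>s. diam (G s)) \<longlongrightarrow> 0) (increasing_in r T) \<longleftrightarrow>
    (\<forall>\<epsilon>>0. \<exists>s\<in>T. \<forall>t\<in>T. (s, t) \<in> r \<longrightarrow>
           (\<forall>x\<in>mspace (G t). \<forall>y\<in>mspace (G t). mdist (G t) x y < \<epsilon>))"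
proof -
  obtain s0 where s0: "s0 \<in> T" using T by blast
  obtain s1 where s1: "s1 \<in> T" "(s0, s1) \<in> r" "s0 \<noteq> s1"
    using strict_upper_bound[of "{s0}" T] s0 T_sub T q by auto
  have diam: "dist (diam (G t)) 0 < \<epsilon> \<longleftrightarrow>
      (\<forall>x\<in>mspace (G t). \<forall>y\<in>mspace (G t). mdist (G t) x y < \<epsilon>)"
    if t: "t \<in> T" "(s1, t) \<in> r" for t \<epsilon>
  proof -
    have "(t, s0) \<notin> r" using t s1 le_trans le_antisym by blast
    then have fin: "finite (mspace (G t))"
      using fin[OF t(1)] s0 unfolding is_least_def by blast
    obtain x where "x \<in> mspace (G t)" using T_two_points[OF t(1)] by metis
    then show ?thesis
      using diam_less_iff[OF fin] diam_nonneg[OF fin] by (simp add: dist_real_def)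
  qed
  have later: "(\<exists>s\<in>T. \<forall>t\<in>T. (s, t) \<in> r \<longrightarrow> P t) \<longleftrightarrow>
      (\<exists>s\<in>T. \<forall>t\<in>T. (s, t) \<in> r \<longrightarrow> (s1, t) \<in> r \<longrightarrow> P t)" for P
  proof (intro iffI)
    assume "\<exists>s\<in>T. \<forall>t\<in>T. (s, t) \<in> r \<longrightarrow> (s1, t) \<in> r \<longrightarrow> P t"
    then obtain s where s: "s \<in> T" "\<And>t. t \<in> T \<Longrightarrow> (s, t) \<in> r \<Longrightarrow> (s1, t) \<in> r \<Longrightarrow> P t" by blast
    then obtain s' where "s' \<in> T" "(s, s') \<in> r" "(s1, s') \<in> r"
      using strict_upper_bound[of "{s, s1}" T] s1 T_sub T q by auto
    then show "\<exists>s\<in>T. \<forall>t\<in>T. (s, t) \<in> r \<longrightarrow> P t" using s le_trans by blast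
  qed blast
  show ?thesis
    unfolding tendsto_iff eventually_increasing_in[OF lin T_sub T]
    by (subst (1 2) later) (use diam in \<open>simp cong: conj_cong\<close>)
qed

lemma codiameters_infinite_iff:
  assumes p: "\<nexists>p. is_least r T p" and T: "T \<noteq> {}"
    and fin: "\<And>s. s \<in> T \<Longrightarrow> \<not> is_greatest r T s \<Longrightarrow> finite (mspace (G s))"
  shows "filterlim (\<lambda>s. codiam (G s)) at_top (decreasing_in r T) \<longleftrightarrow>
    (\<forall>M. \<exists>s\<in>T. \<forall>t\<in>T. (t, s) \<in> r \<longrightarrow>
           (\<forall>x\<in>mspace (G t). \<forall>y\<in>mspace (G t). x \<noteq> y \<longrightarrow> M < mdist (G t) x y))"
proof -
  obtain s0 where s0: "s0 \<in> T" using T by blast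
  obtain s1 where s1: "s1 \<in> T" "(s1, s0) \<in> r" "s0 \<noteq> s1"
    using strict_lower_bound[of "{s0}" T] s0 T_sub T p by auto
  have codiam: "M < codiam (G t) \<longleftrightarrow>
      (\<forall>x\<in>mspace (G t). \<forall>y\<in>mspace (G t). x \<noteq> y \<longrightarrow> M < mdist (G t) x y)"
    if t: "t \<in> T" "(t, s1) \<in> r" for t M
  proof -
    have "(s0, t) \<notin> r" using t s1 le_trans le_antisym by blast
    then have fin: "finite (mspace (G t))"
      using fin[OF t(1)] s0 unfolding is_greatest_def by blast
    obtain x y where "x \<in> mspace (G t)" "y \<in> mspace (G t)" "x \<noteq> y"
      using T_two_points[OF t(1)] by metis
    then show ?thesis using less_codiam_iff[OF fin] by blast
  qed
  have later: "(\<exists>s\<in>T. \<forall>t\<in>T. (t, s) \<in> r \<longrightarrow> P t) \<longleftrightarrow>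
      (\<exists>s\<in>T. \<forall>t\<in>T. (t, s) \<in> r \<longrightarrow> (t, s1) \<in> r \<longrightarrow> P t)" for P
  proof (intro iffI)
    assume "\<exists>s\<in>T. \<forall>t\<in>T. (t, s) \<in> r \<longrightarrow> (t, s1) \<in> r \<longrightarrow> P t"
    then obtain s where s: "s \<in> T" "\<And>t. t \<in> T \<Longrightarrow> (t, s) \<in> r \<Longrightarrow> (t, s1) \<in> r \<Longrightarrow> P t" by blast
    then obtain s' where "s' \<in> T" "(s', s) \<in> r" "(s', s1) \<in> r"
      using strict_lower_bound[of "{s, s1}" T] s1 T_sub T p by auto
    then show "\<exists>s\<in>T. \<forall>t\<in>T. (t, s) \<in> r \<longrightarrow> P t" using s le_trans by blast
  qed blast
  show ?thesis
    unfolding filterlim_at_top_dense eventually_decreasing_in[OF lin T_sub T]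
    by (subst (1 2) later) (use codiam in \<open>simp cong: conj_cong\<close>)
qed

section \<open>Characterization of Heine-Borel products\<close>

lemma compact_if_not_least:
  assumes "Heine_Borel (G s)" "s \<in> T" "\<not> is_least r T s"
  shows "compact_space (mtopology_of (G s))"
proof -
  obtain e where "\<And>x y. x \<in> mspace (G s) \<Longrightarrow> y \<in> mspace (G s) \<Longrightarrow> mdist (G s) x y \<le> e"
    using not_least_bounded[OF assms(2,3)] by blast
  then show ?thesis using Heine_Borel_bounded_iff_compact[of "G s" e] assms(1) by simp
qed

lemma discrete_if_not_greatest:
  assumes "s \<in> T" "\<not> is_greatest r T s"
  shows "topologically_discrete (G s)"
proof -
  obtain e where "e > 0"
    "\<And>x y. x \<in> mspace (G s) \<Longrightarrow> y \<in> mspace (G s) \<Longrightarrow> x \<noteq> y \<Longrightarrow> e \<le> mdist (G s) x y"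
    using not_greatest_uniformly_discrete[OF assms] by blast
  then show ?thesis by (rule uniformly_discrete_topology)
qed

lemma finite_if_inner:
  assumes "Heine_Borel (G s)" "s \<in> T" "\<not> is_least r T s" "\<not> is_greatest r T s"
  shows "finite (mspace (G s))"
  using discrete_compact_finite[OF discrete_if_not_greatest[OF assms(2,4)]
      compact_if_not_least[OF assms(1-3)]] .

theorem Heine_Borel_product_characterization:
  assumes AH: "\<And>s. s \<in> S \<Longrightarrow> absolutely_homogeneous (G s)"
    and two: "\<exists>s\<in>T. \<exists>t\<in>T. s \<noteq> t"
  shows "Heine_Borel (product_metric S r G a) \<longleftrightarrow>
         (finite T \<and>
          (\<exists>p q. is_least r T p \<and> is_greatest r T q \<and>
             compact_space (mtopology_of (G q)) \<and>
             Heine_Borel (G p) \<and> topologically_discrete (G p) \<and>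
             (\<forall>s\<in>T - {p, q}. finite (mspace (G s)))))
       \<or> (\<exists>p. is_least r T p \<and> order_isomorphic_to r T (UNIV :: nat set) \<and>
             Heine_Borel (G p) \<and> topologically_discrete (G p) \<and>
             (\<forall>s\<in>T - {p}. finite (mspace (G s))) \<and>
             ((\<lambda>s. diam (G s)) \<longlongrightarrow> 0) (increasing_in r T))
       \<or> (\<exists>q. is_greatest r T q \<and> order_isomorphic_to r T {i :: int. i < 0} \<and>
             compact_space (mtopology_of (G q)) \<and>
             (\<forall>s\<in>T - {q}. finite (mspace (G s))) \<and>
             filterlim (\<lambda>s. codiam (G s)) at_top (decreasing_in r T))
       \<or> (order_isomorphic_to r T (UNIV :: int set) \<and>
             (\<forall>s\<in>T. finite (mspace (G s))) \<and>
             ((\<lambda>s. diam (G s)) \<longlongrightarrow> 0) (increasing_in r T) \<and>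
             filterlim (\<lambda>s. codiam (G s)) at_top (decreasing_in r T))"
    (is "?HB \<longleftrightarrow> ?finite \<or> ?nat \<or> ?neg \<or> ?int")
proof
  have T: "T \<noteq> {}" using two by blast
  assume HB: ?HB
  have hb: "Heine_Borel (G s)" if "s \<in> T" for s
    using factors_Heine_Borel[OF HB] that T_sub by blast
  have lf: "locally_finite r T"
    unfolding locally_finite_def using Heine_Borel_imp_locally_finite[OF HB] by blast
  have fin: "finite (mspace (G s))" if "s \<in> T" "\<not> is_least r T s" "\<not> is_greatest r T s" for s
    using finite_if_inner hb that by blast
  have up: "((\<lambda>s. diam (G s)) \<longlongrightarrow> 0) (increasing_in r T)" if "\<nexists>q. is_greatest r T q"
  proof -
    have "finite (mspace (G s))" if "s \<in> T" "\<not> is_least r T s" for s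
      using fin that \<open>\<nexists>q. is_greatest r T q\<close> by blast
    from diameters_vanish_iff[OF that T this] show ?thesis
      using Heine_Borel_imp_diameters_vanish[OF HB T that] by simp
  qed
  have down: "filterlim (\<lambda>s. codiam (G s)) at_top (decreasing_in r T)" if "\<nexists>p. is_least r T p"
  proof -
    have "finite (mspace (G s))" if "s \<in> T" "\<not> is_greatest r T s" for s
      using fin that \<open>\<nexists>p. is_least r T p\<close> by blast
    from codiameters_infinite_iff[OF that T this] show ?thesis
      using Heine_Borel_imp_codiameters_infinite[OF HB AH T that] by simp
  qed
  show "?finite \<or> ?nat \<or> ?neg \<or> ?int"
  proof (cases "\<exists>p. is_least r T p")
    case True
    then obtain p where p: "is_least r T p" by blast
    have pT: "p \<in> T" using p by (simp add: is_least_def)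
    have p_iff: "is_least r T s \<longleftrightarrow> s = p" for s using p least_unique by blast
    show ?thesis
    proof (cases "\<exists>q. is_greatest r T q")
      case True
      then obtain q where q: "is_greatest r T q" by blast
      have qT: "q \<in> T" using q by (simp add: is_greatest_def)
      have q_iff: "is_greatest r T s \<longleftrightarrow> s = q" for s
        using q le_antisym unfolding is_greatest_def by blast
      have "finite {u \<in> T. (p, u) \<in> r \<and> (u, q) \<in> r}"
        using lf pT qT unfolding locally_finite_def by blast
      moreover have "T \<subseteq> {u \<in> T. (p, u) \<in> r \<and> (u, q) \<in> r}"
        using p q unfolding is_least_def is_greatest_def by blast
      ultimately have "finite T" by (rule rev_finite_subset)
      moreover have pq: "p \<noteq> q"
      proof
        assume "p = q"
        then have "(p, t) \<in> r" "(t, p) \<in> r" if "t \<in> T" for t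
          using p q that by (auto simp: is_least_def is_greatest_def)
        then have "t = p" if "t \<in> T" for t using le_antisym that by blast
        then show False using two by blast
      qed
      moreover have "compact_space (mtopology_of (G q))"
        by (rule compact_if_not_least[OF hb[OF qT] qT]) (use p_iff pq in simp)
      moreover have "topologically_discrete (G p)"
        by (rule discrete_if_not_greatest[OF pT]) (use q_iff pq in simp)
      moreover have "\<forall>s\<in>T - {p, q}. finite (mspace (G s))"
        using fin by (simp add: p_iff q_iff)
      ultimately have ?finite using p q hb pT by blast
      then show ?thesis by blast
    next
      case False
      have "order_isomorphic_to r T (UNIV :: nat set)"
        by (rule order_isomorphic_nat_if[OF T_sub lf p False])
      moreover have "topologically_discrete (G p)"
        using discrete_if_not_greatest[OF pT] False by blast
      moreover have "\<forall>s\<in>T - {p}. finite (mspace (G s))"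
        using fin False by (simp add: p_iff)
      ultimately have ?nat using p hb pT up[OF False] by blast
      then show ?thesis by blast
    qed
  next
    case no_p: False
    show ?thesis
    proof (cases "\<exists>q. is_greatest r T q")
      case True
      then obtain q where q: "is_greatest r T q" by blast
      have qT: "q \<in> T" using q by (simp add: is_greatest_def)
      have q_iff: "is_greatest r T s \<longleftrightarrow> s = q" for s
        using q le_antisym unfolding is_greatest_def by blast
      have "order_isomorphic_to r T {i :: int. i < 0}"
        by (rule order_isomorphic_negative_int_if[OF T_sub lf no_p q])
      moreover have "compact_space (mtopology_of (G q))"
        using compact_if_not_least[OF hb[OF qT] qT] no_p by blast
      moreover have "\<forall>s\<in>T - {q}. finite (mspace (G s))"
        using fin no_p by (simp add: q_iff)
      ultimately have ?neg using q down[OF no_p] by blast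
      then show ?thesis by blast
    next
      case False
      have "order_isomorphic_to r T (UNIV :: int set)"
        by (rule order_isomorphic_int_if[OF T_sub T lf no_p False])
      then have ?int using fin no_p False up[OF False] down[OF no_p] by blast
      then show ?thesis by blast
    qed
  qed
next
  have T: "T \<noteq> {}" using two by blast
  note fin_HB = compact_imp_Heine_Borel[OF finite_imp_compact_space_mtopology]
  assume "?finite \<or> ?nat \<or> ?neg \<or> ?int"
  then consider ?finite | ?nat | ?neg | ?int by blast
  then show ?HB
  proof cases
    case 1
    then obtain p q where pq: "is_least r T p" "is_greatest r T q"
      "compact_space (mtopology_of (G q))" "Heine_Borel (G p)"
      "\<forall>s\<in>T - {p, q}. finite (mspace (G s))" by blast
    have "Heine_Borel (G s)" if "s \<in> T" for s
      using that pq(3-5) compact_imp_Heine_Borel[of "G s"] fin_HB[of "G s"] by blast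
    then show ?thesis
      using 1 pq(1,2) by (intro locally_finite_imp_Heine_Borel) auto
  next
    case 2
    then obtain p where p: "is_least r T p" "order_isomorphic_to r T (UNIV :: nat set)"
      "Heine_Borel (G p)" "\<forall>s\<in>T - {p}. finite (mspace (G s))"
      "((\<lambda>s. diam (G s)) \<longlongrightarrow> 0) (increasing_in r T)" by blast
    have no_q: "\<nexists>q. is_greatest r T q"
      by (rule order_isomorphic_no_greatest[OF p(2)]) (auto intro: lessI)
    have lf: "locally_finite r T"
      by (rule order_isomorphic_locally_finite[OF p(2)]) simp
    have hb: "Heine_Borel (G s)" if "s \<in> T" for s
      using that p(3,4) fin_HB[of "G s"] by blast
    have "finite (mspace (G s))" if "s \<in> T" "\<not> is_least r T s" for s
      using that p(1,4) by blast
    note up = iffD1[OF diameters_vanish_iff[OF no_q T this] p(5)]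
    show ?thesis
      by (rule locally_finite_imp_Heine_Borel)
        (use hb lf p(1) up in \<open>auto simp: locally_finite_def\<close>)
  next
    case 3
    then obtain q where q: "is_greatest r T q" "order_isomorphic_to r T {i :: int. i < 0}"
      "compact_space (mtopology_of (G q))" "\<forall>s\<in>T - {q}. finite (mspace (G s))"
      "filterlim (\<lambda>s. codiam (G s)) at_top (decreasing_in r T)" by blast
    have no_p: "\<nexists>p. is_least r T p"
    proof (rule order_isomorphic_no_least[OF q(2)])
      fix b :: int assume "b \<in> {i. i < 0}"
      then show "\<exists>c\<in>{i. i < 0}. c < b" by (intro bexI[of _ "b - 1"]) auto
    qed
    have lf: "locally_finite r T"
      by (rule order_isomorphic_locally_finite[OF q(2)]) simp
    have hb: "Heine_Borel (G s)" if "s \<in> T" for s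
      using that q(3,4) compact_imp_Heine_Borel[of "G s"] fin_HB[of "G s"] by blast
    have "finite (mspace (G s))" if "s \<in> T" "\<not> is_greatest r T s" for s
      using that q(1,4) by blast
    note down = iffD1[OF codiameters_infinite_iff[OF no_p T this] q(5)]
    show ?thesis
      by (rule locally_finite_imp_Heine_Borel)
        (use hb lf q(1) down in \<open>auto simp: locally_finite_def\<close>)
  next
    case 4
    have no_p: "\<nexists>p. is_least r T p"
      by (rule order_isomorphic_no_least[of _ _ "UNIV :: int set"]) (use 4 lt_ex in auto)
    have no_q: "\<nexists>q. is_greatest r T q"
      by (rule order_isomorphic_no_greatest[of _ _ "UNIV :: int set"]) (use 4 gt_ex in auto)
    have lf: "locally_finite r T"
      by (rule order_isomorphic_locally_finite[of _ _ "UNIV :: int set"]) (use 4 in auto)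
    have fin: "finite (mspace (G s))" if "s \<in> T" for s
      using that 4 by blast
    note up = iffD1[OF diameters_vanish_iff[OF no_q T fin] 4[THEN conjunct2, THEN conjunct2, THEN conjunct1]]
      and down = iffD1[OF codiameters_infinite_iff[OF no_p T fin] 4[THEN conjunct2, THEN conjunct2, THEN conjunct2]]
    show ?thesis
      by (rule locally_finite_imp_Heine_Borel)
        (use fin_HB[OF fin] lf up down in \<open>auto simp: locally_finite_def\<close>)
  qed
qed

lemma finite_product_Heine_Borel:
  assumes "finite S" "\<And>s. s \<in> S \<Longrightarrow> Heine_Borel (G s)"
  shows "Heine_Borel (product_metric S r G a)"
proof -
  have "finite T" using assms(1) T_sub finite_subset by blast
  then have "\<exists>p. is_least r T p" "\<exists>q. is_greatest r T q" if "T \<noteq> {}"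
    using that finite_has_least finite_has_greatest T_sub by auto
  then show ?thesis
    using assms T_sub \<open>finite T\<close> by (intro locally_finite_imp_Heine_Borel) auto
qed

end

section \<open>Transport of metrics\<close>

lemma isometry_homeomorphic_map:
  assumes "bij_betw g (mspace m') (mspace m)"
    and "\<And>x y. x \<in> mspace m' \<Longrightarrow> y \<in> mspace m' \<Longrightarrow> mdist m (g x) (g y) = mdist m' x y"
  shows "homeomorphic_map (mtopology_of m') (mtopology_of m) g"
  using Metric_space12.isometry_imp_homeomorphic_map[OF Metric_space12_mspace_mdist, of g m' m] assms
  by (simp add: mtopology_of_def bij_betw_def)

lemma isometry_absolutely_homogeneous:
  assumes g: "bij_betw g (mspace m') (mspace m)"
    and iso: "\<And>x y. x \<in> mspace m' \<Longrightarrow> y \<in> mspace m' \<Longrightarrow> mdist m (g x) (g y) = mdist m' x y"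
    and AH: "absolutely_homogeneous m"
  shows "absolutely_homogeneous m'"
  unfolding absolutely_homogeneous_def
proof (intro allI impI)
  fix A f assume *: "A \<subseteq> mspace m' \<and> isometry_on m' A f"
  define k where "k = inv_into (mspace m') g"
  have k: "bij_betw k (mspace m) (mspace m')" unfolding k_def by (rule bij_betw_inv_into[OF g])
  have kg: "k (g x) = x" if "x \<in> mspace m'" for x
    using g that unfolding k_def by (simp add: bij_betw_def)
  have gk: "g (k x) = x" if "x \<in> mspace m" for x
    using g that unfolding k_def by (simp add: bij_betw_def f_inv_into_f)
  have gM: "g x \<in> mspace m" if "x \<in> mspace m'" for x using g that by (auto simp: bij_betw_def)
  have kM: "k x \<in> mspace m'" if "x \<in> mspace m" for x using k that by (auto simp: bij_betw_def)
  have A: "x \<in> mspace m'" "f x \<in> mspace m'" if "x \<in> A" for x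
    using * that by (auto simp: isometry_on_def)
  have "g ` A \<subseteq> mspace m \<and> isometry_on m (g ` A) (g \<circ> f \<circ> k)"
    using * A by (auto simp: isometry_on_def kg gM iso)
  then obtain h where h: "bij_betw h (mspace m) (mspace m)" "isometry_on m (mspace m) h"
    "\<forall>x\<in>g ` A. h x = (g \<circ> f \<circ> k) x"
    using AH[unfolded absolutely_homogeneous_def, rule_format, of "g ` A" "g \<circ> f \<circ> k"] by blast
  have hM: "h x \<in> mspace m" if "x \<in> mspace m" for x using h that by (auto simp: isometry_on_def)
  have "bij_betw (k \<circ> (h \<circ> g)) (mspace m') (mspace m')"
    using g h(1) k by (blast intro: bij_betw_trans)
  moreover have "isometry_on m' (mspace m') (k \<circ> (h \<circ> g))"
    using h(2) by (auto simp: isometry_on_def gM hM kM gk iso simp flip: iso)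
  moreover have "\<forall>x\<in>A. (k \<circ> (h \<circ> g)) x = f x"
    using h(3) A by (simp add: kg)
  ultimately show "\<exists>g. bij_betw g (mspace m') (mspace m') \<and> isometry_on m' (mspace m') g \<and>
      (\<forall>x\<in>A. g x = f x)"
    by blast
qed

lemma isometry_Heine_Borel:
  assumes g: "bij_betw g (mspace m') (mspace m)"
    and iso: "\<And>x y. x \<in> mspace m' \<Longrightarrow> y \<in> mspace m' \<Longrightarrow> mdist m (g x) (g y) = mdist m' x y"
    and HB: "Heine_Borel m"
  shows "Heine_Borel m'"
  unfolding Heine_Borel_def
proof (intro ballI allI)
  fix x e assume x: "x \<in> mspace m'"
  have "g ` mcball_of m' x e = mcball_of m (g x) e"
  proof (intro equalityI subsetI)
    fix y assume "y \<in> g ` mcball_of m' x e"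
    then show "y \<in> mcball_of m (g x) e" using g iso by (auto simp: bij_betw_def)
  next
    fix y assume y: "y \<in> mcball_of m (g x) e"
    then obtain z where "z \<in> mspace m'" "y = g z" using g by (auto simp: bij_betw_def)
    then show "y \<in> g ` mcball_of m' x e" using y x iso by auto
  qed
  moreover have "compactin (mtopology_of m) (mcball_of m (g x) e)"
    using HB x g by (auto simp: Heine_Borel_def bij_betw_def)
  moreover have "mcball_of m' x e \<subseteq> topspace (mtopology_of m')" by (simp add: subset_iff)
  ultimately show "compactin (mtopology_of m') (mcball_of m' x e)"
    using homeomorphic_map_compactness[OF isometry_homeomorphic_map[OF g iso], of "mcball_of m' x e"]
    by auto
qed

definition pullback_metric :: "('b \<Rightarrow> 'a) \<Rightarrow> 'b set \<Rightarrow> 'a metric \<Rightarrow> 'b metric" where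
  "pullback_metric g M m = metric (M, \<lambda>x y. mdist m (g x) (g y))"

lemma pullback_metric:
  assumes "inj_on g M" "g ` M \<subseteq> mspace m"
  shows mspace_pullback: "mspace (pullback_metric g M m) = M"
    and mdist_pullback: "mdist (pullback_metric g M m) x y = mdist m (g x) (g y)"
proof -
  interpret Metric_space M "\<lambda>x y. mdist m (g x) (g y)"
  proof
    fix x y assume "x \<in> M" "y \<in> M"
    then show "mdist m (g x) (g y) = 0 \<longleftrightarrow> x = y"
      using assms by (subst mdist_zero) (auto simp: inj_on_def)
  next
    fix x y z assume "x \<in> M" "y \<in> M" "z \<in> M"
    then show "mdist m (g x) (g z) \<le> mdist m (g x) (g y) + mdist m (g y) (g z)"
      using assms by (intro mdist_triangle) auto
  qed (auto simp: mdist_commute)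
  show "mspace (pullback_metric g M m) = M"
    "mdist (pullback_metric g M m) x y = mdist m (g x) (g y)"
    by (simp_all add: pullback_metric_def)
qed

text \<open>The metric is pulled back along a homeomorphism, which thereby becomes an isometry.\<close>

lemma admits_if_homeomorphic:
  fixes X :: "'a topology" and Y :: "'b topology"
  assumes "admits_AB_HO_Heine_Borel_metric X" "Y homeomorphic_space X"
  shows "admits_AB_HO_Heine_Borel_metric Y"
proof -
  obtain m where m: "mtopology_of m = X" "absolutely_homogeneous m" "Heine_Borel m"
    using assms(1) unfolding admits_AB_HO_Heine_Borel_metric_def by blast
  obtain g where hom: "homeomorphic_map Y X g" using assms(2) homeomorphic_space by blast
  then have g: "bij_betw g (topspace Y) (mspace m)"
    using m(1) homeomorphic_imp_injective_map homeomorphic_imp_surjective_map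
    by (fastforce simp: bij_betw_def)
  define m' where "m' = pullback_metric g (topspace Y) m"
  have M: "mspace m' = topspace Y" and d: "\<And>x y. mdist m (g x) (g y) = mdist m' x y"
    using pullback_metric[of g "topspace Y" m] g by (auto simp: m'_def bij_betw_def)
  have g': "bij_betw g (mspace m') (mspace m)" using g M by simp
  have hom': "homeomorphic_map (mtopology_of m') X g"
    using isometry_homeomorphic_map[OF g' d] m(1) by simp
  have "openin (mtopology_of m') U \<longleftrightarrow> openin Y U" for U
    using homeomorphic_map_openness_eq[OF hom] homeomorphic_map_openness_eq[OF hom'] M by auto
  then have "mtopology_of m' = Y" by (simp add: topology_eq)
  then show ?thesis
    using isometry_absolutely_homogeneous[OF g' d m(2)] isometry_Heine_Borel[OF g' d m(3)]
    unfolding admits_AB_HO_Heine_Borel_metric_def by blast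
qed

section \<open>Subsets of Euclidean spaces\<close>

lemma isometry_surj:
  fixes g :: "'a::euclidean_space \<Rightarrow> 'a"
  assumes "\<And>x y. dist (g x) (g y) = dist x y"
  shows "surj g"
proof -
  have "orthogonal_transformation (\<lambda>x. g x - g 0)"
    unfolding orthogonal_transformation_isometry using assms by (simp add: dist_norm)
  then have s: "surj (\<lambda>x. g x - g 0)" by (rule orthogonal_transformation_surj)
  show ?thesis
    unfolding surj_def
  proof
    fix y
    obtain x where "y - g 0 = g x - g 0" using s unfolding surj_def by blast
    then show "\<exists>x. y = g x" by auto
  qed
qed

text \<open>If \<open>b \<noteq> c\<close>, this is the reflection in the hyperplane that bisects the segment from \<open>b\<close> to
  \<open>c\<close>, whose points are those equidistant from \<open>b\<close> and \<open>c\<close>.\<close>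

lemma reflection_exists:
  fixes b c :: "'a::euclidean_space"
  obtains R where "\<And>x y. dist (R x) (R y) = dist x y" "R b = c"
    "\<And>x. dist x b = dist x c \<Longrightarrow> R x = x"
proof (cases "b = c")
  case True
  then show thesis using that[of "\<lambda>x. x"] by simp
next
  case False
  define n where "n = b - c"
  have n: "n \<bullet> n \<noteq> 0" using False by (simp add: n_def)
  define R where "R x = x - (2 * ((x - (b + c) /\<^sub>R 2) \<bullet> n) / (n \<bullet> n)) *\<^sub>R n" for x
  have "dist (R x) (R y) = dist x y" for x y
  proof -
    define v where "v = x - y"
    define \<alpha> where "\<alpha> = 2 * (v \<bullet> n) / (n \<bullet> n)"
    have "\<alpha> * (n \<bullet> n) = 2 * (v \<bullet> n)" using n by (simp add: \<alpha>_def)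
    then have \<alpha>: "\<alpha> * (\<alpha> * (n \<bullet> n)) = \<alpha> * (2 * (v \<bullet> n))" by simp
    have "R x - R y = v - \<alpha> *\<^sub>R n"
      unfolding \<alpha>_def R_def v_def
      by (simp add: algebra_simps inner_diff_left inner_add_left diff_divide_distrib add_divide_distrib
          flip: scaleR_left_distrib)
    then have "(R x - R y) \<bullet> (R x - R y) = v \<bullet> v"
      using \<alpha> by (simp only:) (simp add: inner_diff_left inner_diff_right inner_commute algebra_simps)
    then show ?thesis by (simp add: dist_norm norm_eq_sqrt_inner v_def)
  qed
  moreover have "R b = c"
  proof -
    have "b - (b + c) /\<^sub>R 2 = n /\<^sub>R 2"
      by (simp add: n_def algebra_simps flip: scaleR_2)
    then have e: "2 * ((b - (b + c) /\<^sub>R 2) \<bullet> n) / (n \<bullet> n) = 1" using n by simp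
    show ?thesis unfolding R_def e by (simp add: n_def)
  qed
  moreover have "R x = x" if "dist x b = dist x c" for x
  proof -
    have "(x - b) \<bullet> (x - b) = (x - c) \<bullet> (x - c)"
      using that by (simp add: dist_norm norm_eq)
    then have "(x - (b + c) /\<^sub>R 2) \<bullet> n = 0"
      unfolding n_def by (simp add: inner_diff_left inner_diff_right inner_add_left inner_commute algebra_simps)
    then show ?thesis by (simp add: R_def)
  qed
  ultimately show thesis using that by blast
qed

lemma affine_bisector: "affine {x::'a::euclidean_space. dist x a = dist x b}"
proof -
  have "{x. dist x a = dist x b} = {x. (b - a) \<bullet> x = (b \<bullet> b - a \<bullet> a) / 2}"
    by (auto simp: dist_norm norm_eq inner_diff_left inner_diff_right inner_commute algebra_simps)
  then show ?thesis by (simp only: affine_hyperplane)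
qed

text \<open>Let \<open>g\<close> be an isometry that agrees with \<open>f\<close> on the part \<open>E g\<close> of \<open>A\<close> but not at \<open>a\<close>.  The points of
  \<open>f ` E g\<close> are equidistant from \<open>g a\<close> and \<open>f a\<close>.  The reflection that maps \<open>g a\<close> to \<open>f a\<close>
  therefore fixes \<open>f ` E g\<close>, and its composition with \<open>g\<close> agrees with \<open>f\<close> on
  \<open>insert a (E g)\<close>.  For the same reason \<open>a\<close> is not in the affine hull of \<open>E g\<close>, so that the
  affine dimension of the set of agreement grows, which can happen only finitely often.\<close>

lemma partial_isometry_extends:
  fixes f :: "'a::euclidean_space \<Rightarrow> 'a"
  assumes f: "\<And>x y. x \<in> A \<Longrightarrow> y \<in> A \<Longrightarrow> dist (f x) (f y) = dist x y"
  obtains g where "\<And>x y. dist (g x) (g y) = dist x y" "\<And>x. x \<in> A \<Longrightarrow> g x = f x"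
proof -
  define E where "E g = {x \<in> A. g x = f x}" for g
  have "\<exists>g. (\<forall>x y. dist (g x) (g y) = dist x y) \<and> (E g = A \<or> int n \<le> aff_dim (E g) + 1)" for n
  proof (induction n)
    case 0
    have "0 \<le> aff_dim (E (\<lambda>x. x)) + 1" using aff_dim_geq[of "E (\<lambda>x. x)"] by simp
    then show ?case by (intro exI[of _ "\<lambda>x. x"]) simp
  next
    case (Suc n)
    then obtain g where g: "\<And>x y. dist (g x) (g y) = dist x y"
      "E g = A \<or> int n \<le> aff_dim (E g) + 1" by blast
    show ?case
    proof (cases "E g = A")
      case True
      then show ?thesis using g by blast
    next
      case False
      then obtain a where a: "a \<in> A" "g a \<noteq> f a" by (auto simp: E_def)
      obtain a' where a': "g a' = f a" using isometry_surj[OF g(1)] by (metis surjD)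
      obtain R where R: "\<And>x y. dist (R x) (R y) = dist x y" "R (g a) = f a"
        "\<And>x. dist x (g a) = dist x (f a) \<Longrightarrow> R x = x"
        using reflection_exists[of "g a" "f a"] by metis
      have eq: "dist x a = dist x a'" "dist (g x) (g a) = dist (g x) (f a)" if "x \<in> E g" for x
      proof -
        have "dist (g x) (f a) = dist x a" using that a f by (auto simp: E_def)
        then show "dist x a = dist x a'" "dist (g x) (g a) = dist (g x) (f a)"
          using g(1)[of x a'] g(1)[of x a] by (auto simp: a')
      qed
      have "affine hull E g \<subseteq> {x. dist x a = dist x a'}"
        by (rule hull_minimal) (use eq(1) affine_bisector in auto)
      moreover have "a \<noteq> a'" using a a' by auto
      ultimately have "a \<notin> affine hull E g" by auto
      then have "aff_dim (insert a (E g)) = aff_dim (E g) + 1" by (simp add: aff_dim_insert)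
      moreover have "insert a (E g) \<subseteq> E (R \<circ> g)"
        using a R eq(2) by (auto simp: E_def)
      ultimately have "aff_dim (E g) + 1 \<le> aff_dim (E (R \<circ> g))" using aff_dim_subset by metis
      then have "int (Suc n) \<le> aff_dim (E (R \<circ> g)) + 1" using g(2) False by simp
      moreover have "\<forall>x y. dist ((R \<circ> g) x) ((R \<circ> g) y) = dist x y" using g(1) R(1) by simp
      ultimately show ?thesis by blast
    qed
  qed
  from this[of "DIM('a) + 2"] obtain g where g: "\<And>x y. dist (g x) (g y) = dist x y"
    "E g = A \<or> int (DIM('a) + 2) \<le> aff_dim (E g) + 1" by blast
  then have "E g = A" using aff_dim_le_DIM[of "E g"] by linarith
  then have "g x = f x" if "x \<in> A" for x using that unfolding E_def by blast
  then show thesis using that g(1) by blast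
qed

lemma absolutely_homogeneous_submetric_euclidean:
  fixes M :: "'a::euclidean_space set"
  assumes "\<And>A f. A \<subseteq> M \<Longrightarrow> f \<in> A \<rightarrow> M \<Longrightarrow> \<forall>x\<in>A. \<forall>y\<in>A. dist (f x) (f y) = dist x y \<Longrightarrow>
    \<exists>g. (\<forall>x y. dist (g x) (g y) = dist x y) \<and> (\<forall>x\<in>A. g x = f x) \<and> g ` M = M"
  shows "absolutely_homogeneous (submetric euclidean_metric M)"
  unfolding absolutely_homogeneous_def
proof (intro allI impI)
  fix A f assume "A \<subseteq> mspace (submetric euclidean_metric M) \<and>
    isometry_on (submetric euclidean_metric M) A f"
  then obtain g where g: "\<forall>x y. dist (g x) (g y) = dist x y" "\<forall>x\<in>A. g x = f x" "g ` M = M"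
    using assms[of A f] by (auto simp: isometry_on_def)
  have "inj_on g M" by (rule inj_onI) (metis g(1) dist_eq_0_iff)
  then show "\<exists>g. bij_betw g (mspace (submetric euclidean_metric M)) (mspace (submetric euclidean_metric M)) \<and>
      isometry_on (submetric euclidean_metric M) (mspace (submetric euclidean_metric M)) g \<and>
      (\<forall>x\<in>A. g x = f x)"
    using g by (intro exI[of _ g]) (auto simp: isometry_on_def bij_betw_def)
qed

lemma Heine_Borel_submetric_euclidean:
  fixes M :: "'a::euclidean_space set"
  assumes "closed M"
  shows "Heine_Borel (submetric euclidean_metric M)"
  unfolding Heine_Borel_def
proof (intro ballI allI)
  fix x e assume x: "x \<in> mspace (submetric euclidean_metric M)"
  then have "mcball_of (submetric euclidean_metric M) x e = M \<inter> cball x e"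
    by auto
  moreover have "compact (M \<inter> cball x e)" using assms compact_cball closed_Int_compact by blast
  ultimately show "compactin (mtopology_of (submetric euclidean_metric M))
      (mcball_of (submetric euclidean_metric M) x e)"
    by (simp add: mtopology_of_submetric compactin_subtopology)
qed

lemma euclidean_admits: "admits_AB_HO_Heine_Borel_metric (euclidean :: 'a::euclidean_space topology)"
proof -
  have "absolutely_homogeneous (submetric (euclidean_metric :: 'a metric) UNIV)"
  proof (rule absolutely_homogeneous_submetric_euclidean)
    fix A and f :: "'a \<Rightarrow> 'a" assume f: "\<forall>x\<in>A. \<forall>y\<in>A. dist (f x) (f y) = dist x y"
    obtain g where "\<And>x y. dist (g x) (g y) = dist x y" "\<And>x. x \<in> A \<Longrightarrow> g x = f x"
      using partial_isometry_extends[of A f] f by blast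
    then show "\<exists>g. (\<forall>x y. dist (g x) (g y) = dist x y) \<and> (\<forall>x\<in>A. g x = f x) \<and> g ` UNIV = UNIV"
      using isometry_surj[of g] by blast
  qed
  moreover have "Heine_Borel (submetric (euclidean_metric :: 'a metric) UNIV)"
    by (rule Heine_Borel_submetric_euclidean) simp
  ultimately show ?thesis
    unfolding admits_AB_HO_Heine_Borel_metric_def
    by (intro exI[of _ euclidean_metric]) simp
qed

lemma sphere_absolutely_homogeneous:
  "absolutely_homogeneous (submetric euclidean_metric (sphere (0::'a::euclidean_space) 1))"
proof (rule absolutely_homogeneous_submetric_euclidean)
  fix A and f :: "'a \<Rightarrow> 'a"
  assume A: "A \<subseteq> sphere 0 1" and fA: "f \<in> A \<rightarrow> sphere 0 1"
    and f: "\<forall>x\<in>A. \<forall>y\<in>A. dist (f x) (f y) = dist x y"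
  \<comment> \<open>all points of the sphere have distance 1 from 0, so \<open>f\<close> may be extended by \<open>0 \<mapsto> 0\<close>\<close>
  define h where "h x = (if x = 0 then 0 else f x)" for x
  have "dist (h x) (h y) = dist x y" if "x \<in> insert 0 A" "y \<in> insert 0 A" for x y
    using that A fA f by (force simp: h_def)
  then obtain g where g: "\<And>x y. dist (g x) (g y) = dist x y" "\<And>x. x \<in> insert 0 A \<Longrightarrow> g x = h x"
    using partial_isometry_extends[of "insert 0 A" h] by blast
  have "g 0 = 0" using g(2)[of 0] by (simp add: h_def)
  then have n: "norm (g x) = norm x" for x using g(1)[of x 0] by (simp add: dist_norm)
  have "g ` sphere 0 1 = sphere 0 1"
  proof (intro equalityI subsetI)
    fix y assume y: "y \<in> sphere (0::'a) 1"
    obtain x where "y = g x" using isometry_surj[OF g(1)] by (metis surjD)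
    then show "y \<in> g ` sphere 0 1" using y n by auto
  qed (use n in auto)
  moreover have "0 \<notin> A" using A by auto
  then have "\<forall>x\<in>A. g x = f x" using g(2) by (auto simp: h_def)
  ultimately show "\<exists>g. (\<forall>x y. dist (g x) (g y) = dist x y) \<and> (\<forall>x\<in>A. g x = f x) \<and>
      g ` sphere 0 1 = sphere 0 1"
    using g(1) by blast
qed

section \<open>Countable discrete spaces\<close>

text \<open>An infinite discrete space with distances at least 3.  This will be more than the
  distances in the compact spaces with which it is multiplied.\<close>

definition multiples_of_3 :: "real set" where
  "multiples_of_3 = range (\<lambda>k::int. 3 * of_int k)"

lemma multiples_of_3_dist:
  assumes "x \<in> multiples_of_3" "y \<in> multiples_of_3" "x \<noteq> y"
  shows "3 \<le> dist x y"
proof -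
  obtain k l :: int where kl: "x = 3 * of_int k" "y = 3 * of_int l"
    using assms by (auto simp: multiples_of_3_def)
  then have "1 \<le> \<bar>k - l\<bar>" using assms by auto
  then have "1 \<le> \<bar>real_of_int k - real_of_int l\<bar>" by linarith
  then show ?thesis unfolding dist_real_def kl by linarith
qed

text \<open>An isometry of the line that maps one multiple of 3 to a multiple of 3 maps all of them
  to such multiples, and no other points.\<close>

lemma multiples_of_3_absolutely_homogeneous:
  "absolutely_homogeneous (submetric euclidean_metric multiples_of_3)"
proof (rule absolutely_homogeneous_submetric_euclidean)
  fix A and f :: "real \<Rightarrow> real"
  assume A: "A \<subseteq> multiples_of_3" and fA: "f \<in> A \<rightarrow> multiples_of_3"
    and f: "\<forall>x\<in>A. \<forall>y\<in>A. dist (f x) (f y) = dist x y"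
  show "\<exists>g. (\<forall>x y. dist (g x) (g y) = dist x y) \<and> (\<forall>x\<in>A. g x = f x) \<and>
      g ` multiples_of_3 = multiples_of_3"
  proof (cases "A = {}")
    case True
    then show ?thesis by (intro exI[of _ "\<lambda>x. x"]) simp
  next
    case False
    then obtain a where a: "a \<in> A" by blast
    obtain g where g: "\<And>x y. dist (g x) (g y) = dist x y" "\<And>x. x \<in> A \<Longrightarrow> g x = f x"
      using partial_isometry_extends[of A f] f by blast
    have "a \<in> multiples_of_3" "g a \<in> multiples_of_3" using a A fA g(2)[OF a] by auto
    then obtain k l :: int where kl: "a = 3 * of_int k" "g a = 3 * of_int l"
      unfolding multiples_of_3_def by blast
    have iff: "g x \<in> multiples_of_3 \<longleftrightarrow> x \<in> multiples_of_3" for x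
    proof -
      have "\<bar>g x - 3 * of_int l\<bar> = \<bar>x - 3 * of_int k\<bar>"
        using g(1)[of x a] kl by (simp add: dist_real_def)
      then have *: "g x = 3 * of_int l + (x - 3 * of_int k) \<or> g x = 3 * of_int l - (x - 3 * of_int k)"
        by linarith
      have "y = 3 * of_int j \<Longrightarrow> y \<in> multiples_of_3" for y and j :: int
        by (auto simp: multiples_of_3_def)
      note mem = this
      show ?thesis
      proof
        assume "g x \<in> multiples_of_3"
        then obtain j :: int where "g x = 3 * of_int j" by (auto simp: multiples_of_3_def)
        then have "x = 3 * of_int (j - l + k) \<or> x = 3 * of_int (l - j + k)" using * by auto
        then show "x \<in> multiples_of_3" using mem by blast
      next
        assume "x \<in> multiples_of_3"
        then obtain j :: int where "x = 3 * of_int j" by (auto simp: multiples_of_3_def)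
        then have "g x = 3 * of_int (l + j - k) \<or> g x = 3 * of_int (l - j + k)" using * by auto
        then show "g x \<in> multiples_of_3" using mem by blast
      qed
    qed
    have "g ` multiples_of_3 = multiples_of_3"
    proof (intro equalityI subsetI)
      fix y assume y: "y \<in> multiples_of_3"
      obtain x where "y = g x" using isometry_surj[OF g(1)] by (metis surjD)
      then show "y \<in> g ` multiples_of_3" using y iff by blast
    qed (use iff in blast)
    then show ?thesis using g by blast
  qed
qed

lemma multiples_of_3_closed: "closed multiples_of_3"
proof (rule discrete_imp_closed)
  show "\<forall>x\<in>multiples_of_3. \<forall>y\<in>multiples_of_3. dist y x < 3 \<longrightarrow> y = x"
    using multiples_of_3_dist by (metis not_le)
qed simp

text \<open>A single positive distance will do for finite \<open>D\<close>.  For infinite \<open>D\<close> the resulting space would be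
  bounded but not compact; then the metric of the multiples of 3 is used.\<close>

lemma countable_discrete_metric:
  fixes D :: "'d set"
  assumes "countable D"
  obtains m where "mspace m = D" "topologically_discrete m" "absolutely_homogeneous m"
    "Heine_Borel m" "\<And>x y. x \<in> D \<Longrightarrow> y \<in> D \<Longrightarrow> x \<noteq> y \<Longrightarrow> 3 \<le> mdist m x y"
proof (cases "finite D")
  case True
  let ?d = "\<lambda>x y::'d. if x = y then 0 else 3 :: real"
  interpret Metric_space D ?d by unfold_locales auto
  define m where "m = metric (D, ?d)"
  have M: "mspace m = D" and d: "mdist m = ?d" by (simp_all add: m_def)
  have "absolutely_homogeneous m"
    unfolding absolutely_homogeneous_def
  proof (intro allI impI)
    fix A f assume *: "A \<subseteq> mspace m \<and> isometry_on m A f"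
    then have A: "A \<subseteq> D" "f ` A \<subseteq> D" and "\<forall>x\<in>A. \<forall>y\<in>A. ?d (f x) (f y) = ?d x y"
      by (auto simp: isometry_on_def M d)
    then have inj: "inj_on f A" by (intro inj_onI) (metis zero_neq_numeral)
    have "finite A" using A True finite_subset by blast
    then have "card (D - A) = card (D - f ` A)"
      using A inj True by (simp add: card_Diff_subset card_image)
    then obtain h where h: "bij_betw h (D - A) (D - f ` A)"
      using True finite_same_card_bij by (metis finite_Diff)
    let ?g = "\<lambda>x. if x \<in> A then f x else h x"
    have "bij_betw ?g A (f ` A)"
      using inj by (auto simp: bij_betw_def inj_on_def)
    moreover have "bij_betw ?g (D - A) (D - f ` A)"
      using h by (rule bij_betw_cong[THEN iffD1, rotated]) auto
    ultimately have "bij_betw ?g (A \<union> (D - A)) (f ` A \<union> (D - f ` A))"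
      by (rule bij_betw_combine) auto
    then have g: "bij_betw ?g D D" using A by (simp add: Un_absorb1)
    then have "isometry_on m D ?g"
      unfolding isometry_on_def M d bij_betw_def inj_on_def by (auto split: if_splits)
    then show "\<exists>g. bij_betw g (mspace m) (mspace m) \<and> isometry_on m (mspace m) g \<and>
        (\<forall>x\<in>A. g x = f x)"
      using g M by (intro exI[of _ ?g]) simp
  qed
  moreover have "Heine_Borel m"
    using True M finite_imp_compact_space_mtopology compact_imp_Heine_Borel by metis
  moreover have "topologically_discrete m"
    by (rule uniformly_discrete_topology[of 3]) (auto simp: d)
  ultimately show thesis using that[of m] by (simp add: M d)
next
  case False
  let ?E = "submetric euclidean_metric multiples_of_3"
  have "inj (\<lambda>k::int. 3 * real_of_int k)" by (auto simp: inj_on_def)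
  then have c: "bij_betw (\<lambda>k::int. 3 * real_of_int k) UNIV multiples_of_3"
    by (simp add: bij_betw_def multiples_of_3_def)
  have "bij_betw (to_nat_on D) D UNIV"
    using to_nat_on_infinite[OF assms False] by simp
  then obtain g where g: "bij_betw g D multiples_of_3"
    using bij_betw_trans[OF _ bij_betw_trans[OF bij_int_decode c]] by blast
  define m where "m = pullback_metric g D ?E"
  have M: "mspace m = D" and d: "mdist m x y = dist (g x) (g y)" for x y
    using pullback_metric[of g D ?E] g by (auto simp: m_def bij_betw_def)
  have g': "bij_betw g (mspace m) (mspace ?E)" using g M by simp
  have d': "mdist ?E (g x) (g y) = mdist m x y" for x y by (simp add: d)
  have far: "3 \<le> mdist m x y" if "x \<in> D" "y \<in> D" "x \<noteq> y" for x y
    using multiples_of_3_dist[of "g x" "g y"] d[of x y] bij_betwE[OF g] that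
      inj_onD[OF bij_betw_imp_inj_on[OF g], of x y] by auto
  have "topologically_discrete m"
    by (rule uniformly_discrete_topology[of 3]) (use far M in auto)
  moreover have "absolutely_homogeneous m"
    by (rule isometry_absolutely_homogeneous[OF g' d' multiples_of_3_absolutely_homogeneous])
  moreover have "Heine_Borel m"
    by (rule isometry_Heine_Borel[OF g' d' Heine_Borel_submetric_euclidean[OF multiples_of_3_closed]])
  ultimately show thesis using that M far by blast
qed

section \<open>The product of a compact space with a discrete one\<close>

text \<open>The space \<open>m1\<close> is to be compact and \<open>m2\<close> discrete.  Points over different elements of
  the discrete space keep the distance of these elements; the bounds 2 and 3 on the distances
  in the two spaces then give the triangle inequality, and make the points over one element of
  the discrete space recognizable from the distances alone.\<close>

definition fibre_dist :: "'a metric \<Rightarrow> 'b metric \<Rightarrow> 'a \<times> 'b \<Rightarrow> 'a \<times> 'b \<Rightarrow> real" where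
  "fibre_dist m1 m2 p q =
     (if snd p = snd q then mdist m1 (fst p) (fst q) else mdist m2 (snd p) (snd q))"

definition fibre_metric :: "'a metric \<Rightarrow> 'b metric \<Rightarrow> ('a \<times> 'b) metric" where
  "fibre_metric m1 m2 = metric (mspace m1 \<times> mspace m2, fibre_dist m1 m2)"

locale fibred =
  fixes m1 :: "'a metric" and m2 :: "'b metric"
  assumes near: "\<And>x y. x \<in> mspace m1 \<Longrightarrow> y \<in> mspace m1 \<Longrightarrow> mdist m1 x y \<le> 2"
    and far: "\<And>i j. i \<in> mspace m2 \<Longrightarrow> j \<in> mspace m2 \<Longrightarrow> i \<noteq> j \<Longrightarrow> 3 \<le> mdist m2 i j"
begin

abbreviation "\<rho> \<equiv> fibre_dist m1 m2"
abbreviation "P \<equiv> mspace m1 \<times> mspace m2"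

sublocale F: Metric_space P \<rho>
proof
  show "0 \<le> \<rho> p q" for p q by (simp add: fibre_dist_def)
  show "\<rho> p q = \<rho> q p" for p q by (auto simp: fibre_dist_def mdist_commute)
  show "\<rho> p q = 0 \<longleftrightarrow> p = q" if "p \<in> P" "q \<in> P" for p q
    using that far[of "snd p" "snd q"] by (auto simp: fibre_dist_def mdist_zero prod_eq_iff)
  show "\<rho> p q \<le> \<rho> p s + \<rho> s q" if "p \<in> P" "q \<in> P" "s \<in> P" for p q s
  proof -
    obtain a i b j c k where [simp]: "p = (a, i)" "q = (b, j)" "s = (c, k)" by fastforce
    have M: "a \<in> mspace m1" "b \<in> mspace m1" "c \<in> mspace m1"
      "i \<in> mspace m2" "j \<in> mspace m2" "k \<in> mspace m2" using that by auto
    consider "i = j" "k = j" | "i = j" "k \<noteq> j" | "i \<noteq> j" by blast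
    then show ?thesis
    proof cases
      case 1
      then show ?thesis using mdist_triangle[of a m1 c b] M by (simp add: fibre_dist_def)
    next
      case 2
      then show ?thesis using near[OF M(1,2)] far[of j k] far[of k j] M by (auto simp: fibre_dist_def)
    next
      case 3
      then show ?thesis
        using mdist_triangle[of i m2 k j] mdist_nonneg[of m1 a c] mdist_nonneg[of m1 c b] M
        by (auto simp: fibre_dist_def)
    qed
  qed
qed

lemma mspace_fibre: "mspace (fibre_metric m1 m2) = P"
  and mdist_fibre: "mdist (fibre_metric m1 m2) = \<rho>"
  and mtopology_fibre: "mtopology_of (fibre_metric m1 m2) = F.mtopology"
  by (simp_all add: fibre_metric_def)

lemma fibre_topology:
  "mtopology_of (fibre_metric m1 m2) = prod_topology (mtopology_of m1) (discrete_topology (mspace m2))"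
  unfolding topology_eq mtopology_fibre
proof
  interpret A: Metric_space "mspace m1" "mdist m1" by simp
  fix U
  show "openin F.mtopology U \<longleftrightarrow>
    openin (prod_topology (mtopology_of m1) (discrete_topology (mspace m2))) U"
  proof
    assume U: "openin F.mtopology U"
    show "openin (prod_topology (mtopology_of m1) (discrete_topology (mspace m2))) U"
      unfolding openin_prod_topology_alt
    proof (intro allI impI)
      fix x i assume xi: "(x, i) \<in> U"
      then obtain e where e: "e > 0" "F.mball (x, i) e \<subseteq> U" and P: "(x, i) \<in> P"
        using U unfolding F.openin_mtopology by blast
      have "A.mball x e \<times> {i} \<subseteq> F.mball (x, i) e"
        using P by (auto simp: fibre_dist_def)
      then show "\<exists>V W. openin (mtopology_of m1) V \<and> openin (discrete_topology (mspace m2)) W \<and>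
          x \<in> V \<and> i \<in> W \<and> V \<times> W \<subseteq> U"
        using e P by (intro exI[of _ "A.mball x e"] exI[of _ "{i}"]) (auto simp: mtopology_of_def)
    qed
  next
    assume U: "openin (prod_topology (mtopology_of m1) (discrete_topology (mspace m2))) U"
    have "U \<subseteq> P" using openin_subset[OF U] by simp
    moreover have "\<exists>e>0. F.mball p e \<subseteq> U" if p: "p \<in> U" for p
    proof -
      obtain x i where xi: "p = (x, i)" by fastforce
      then obtain V W where VW: "openin A.mtopology V" "x \<in> V" "i \<in> W" "V \<times> W \<subseteq> U"
        using U p unfolding openin_prod_topology_alt mtopology_of_def by blast
      then obtain e where e: "e > 0" "A.mball x e \<subseteq> V"
        unfolding A.openin_mtopology by blast
      have "F.mball p (min e 3) \<subseteq> A.mball x e \<times> {i}"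
      proof
        fix q assume q: "q \<in> F.mball p (min e 3)"
        then have "snd q = i" using far[of i "snd q"] by (auto simp: xi fibre_dist_def split: if_splits)
        then show "q \<in> A.mball x e \<times> {i}"
          using q by (cases q) (auto simp: xi fibre_dist_def)
      qed
      then have "F.mball p (min e 3) \<subseteq> U" using e VW by blast
      then show ?thesis using e by (intro exI[of _ "min e 3"]) auto
    qed
    ultimately show "openin F.mtopology U" by (simp add: F.openin_mtopology)
  qed
qed

lemma fibre_Heine_Borel:
  assumes C: "compact_space (mtopology_of m1)" and HB: "Heine_Borel m2"
    and disc: "topologically_discrete m2"
  shows "Heine_Borel (fibre_metric m1 m2)"
  unfolding Heine_Borel_def
proof (intro ballI allI)
  fix p e assume p: "p \<in> mspace (fibre_metric m1 m2)"
  let ?B = "mcball_of (fibre_metric m1 m2) p e"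
  have "compactin (discrete_topology (mspace m2)) (mcball_of m2 (snd p) e)"
    using HB disc p by (auto simp: Heine_Borel_def topologically_discrete_def mspace_fibre)
  then have K: "compactin (mtopology_of (fibre_metric m1 m2)) (mspace m1 \<times> mcball_of m2 (snd p) e)"
    using C unfolding fibre_topology compactin_Times by (simp add: compact_space_def)
  have "?B \<subseteq> mspace m1 \<times> mcball_of m2 (snd p) e"
  proof
    fix q assume q: "q \<in> ?B"
    then have "mdist (fibre_metric m1 m2) p q \<le> e" by simp
    then have "0 \<le> e" using mdist_nonneg[of "fibre_metric m1 m2" p q] by linarith
    then show "q \<in> mspace m1 \<times> mcball_of m2 (snd p) e"
      using q by (cases q) (auto simp: mspace_fibre mdist_fibre fibre_dist_def split: if_splits)
  qed
  moreover have "closedin (mtopology_of (fibre_metric m1 m2)) ?B"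
    by (simp add: mtopology_fibre mcball_of_def mspace_fibre mdist_fibre)
  ultimately show "compactin (mtopology_of (fibre_metric m1 m2)) ?B"
    using K closed_compactin by blast
qed

text \<open>A partial isometry preserves the relation of lying over the same element of the discrete
  space.  It therefore induces a partial isometry of the discrete space and partial isometries
  between the copies of the compact space, and these are extended separately.\<close>

lemma fibre_absolutely_homogeneous:
  assumes AH1: "absolutely_homogeneous m1" and AH2: "absolutely_homogeneous m2"
  shows "absolutely_homogeneous (fibre_metric m1 m2)"
  unfolding absolutely_homogeneous_def
proof (intro allI impI)
  fix A f assume *: "A \<subseteq> mspace (fibre_metric m1 m2) \<and> isometry_on (fibre_metric m1 m2) A f"
  then have AP: "p \<in> P" "f p \<in> P" if "p \<in> A" for p
    using that by (auto simp: isometry_on_def mspace_fibre)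
  have iso: "\<rho> (f p) (f q) = \<rho> p q" if "p \<in> A" "q \<in> A" for p q
    using that * by (auto simp: isometry_on_def mdist_fibre)
  have near_iff: "snd p = snd q \<longleftrightarrow> \<rho> p q \<le> 2" if "p \<in> P" "q \<in> P" for p q
    using that near[of "fst p" "fst q"] far[of "snd p" "snd q"] by (auto simp: fibre_dist_def)
  have snd_iff: "snd (f p) = snd (f q) \<longleftrightarrow> snd p = snd q" if "p \<in> A" "q \<in> A" for p q
    using near_iff[OF AP(1)[OF that(1)] AP(1)[OF that(2)]]
      near_iff[OF AP(2)[OF that(1)] AP(2)[OF that(2)]] iso[OF that] by simp
  \<comment> \<open>the map induced on the discrete factor\<close>
  define \<phi>0 where "\<phi>0 i = snd (f (SOME p. p \<in> A \<and> snd p = i))" for i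
  have \<phi>0: "\<phi>0 (snd p) = snd (f p)" if "p \<in> A" for p
  proof -
    have "(SOME q. q \<in> A \<and> snd q = snd p) \<in> A \<and> snd (SOME q. q \<in> A \<and> snd q = snd p) = snd p"
      by (rule someI[of _ p]) (use that in simp)
    then show ?thesis using snd_iff that unfolding \<phi>0_def by blast
  qed
  have "snd ` A \<subseteq> mspace m2 \<and> isometry_on m2 (snd ` A) \<phi>0"
  proof -
    have "\<phi>0 (snd p) \<in> mspace m2" if "p \<in> A" for p
      using AP(2)[OF that] unfolding \<phi>0[OF that] by auto
    moreover have "mdist m2 (\<phi>0 (snd p)) (\<phi>0 (snd q)) = mdist m2 (snd p) (snd q)"
      if "p \<in> A" "q \<in> A" for p q
    proof (cases "snd p = snd q")
      case True
      then show ?thesis using \<phi>0[OF that(1)] AP[OF that(1)] AP[OF that(2)] by auto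
    next
      case False
      then show ?thesis using iso[OF that] snd_iff[OF that] \<phi>0 that by (simp add: fibre_dist_def)
    qed
    ultimately show ?thesis using AP by (auto simp: isometry_on_def)
  qed
  then obtain \<phi> where \<phi>: "bij_betw \<phi> (mspace m2) (mspace m2)" "isometry_on m2 (mspace m2) \<phi>"
    "\<forall>i\<in>snd ` A. \<phi> i = \<phi>0 i"
    using AH2[unfolded absolutely_homogeneous_def, rule_format, of "snd ` A" \<phi>0] by blast
  have "\<exists>h. bij_betw h (mspace m1) (mspace m1) \<and> isometry_on m1 (mspace m1) h \<and>
      (\<forall>x. (x, i) \<in> A \<longrightarrow> h x = fst (f (x, i)))" for i
  proof -
    have "mdist m1 (fst (f (x, i))) (fst (f (y, i))) = mdist m1 x y"
      if "(x, i) \<in> A" "(y, i) \<in> A" for x y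
      using iso[OF that] snd_iff[OF that] by (simp add: fibre_dist_def)
    moreover have "x \<in> mspace m1" "fst (f (x, i)) \<in> mspace m1" if "(x, i) \<in> A" for x
      using AP[OF that] by auto
    ultimately have "{x. (x, i) \<in> A} \<subseteq> mspace m1 \<and>
        isometry_on m1 {x. (x, i) \<in> A} (\<lambda>x. fst (f (x, i)))"
      by (auto simp: isometry_on_def)
    from AH1[unfolded absolutely_homogeneous_def, rule_format, OF this] show ?thesis by simp
  qed
  then obtain h where h: "\<And>i. bij_betw (h i) (mspace m1) (mspace m1)"
    "\<And>i. isometry_on m1 (mspace m1) (h i)" "\<And>i x. (x, i) \<in> A \<Longrightarrow> h i x = fst (f (x, i))"
    by metis
  define g where "g p = (h (snd p) (fst p), \<phi> (snd p))" for p
  have gP: "g p \<in> P" if "p \<in> P" for p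
    using that bij_betwE[OF h(1)] bij_betwE[OF \<phi>(1)] by (auto simp: g_def)
  have \<phi>_inj: "\<phi> i = \<phi> j \<longleftrightarrow> i = j" if "i \<in> mspace m2" "j \<in> mspace m2" for i j
    using \<phi>(1) that by (auto simp: bij_betw_def inj_on_def)
  have g_iso: "\<rho> (g p) (g q) = \<rho> p q" if "p \<in> P" "q \<in> P" for p q
    using that h(2)[of "snd p"] \<phi>(2) \<phi>_inj[of "snd p" "snd q"]
    by (auto simp: g_def fibre_dist_def isometry_on_def)
  have "inj_on g P"
    by (rule inj_onI) (metis F.zero g_iso gP)
  moreover have "P \<subseteq> g ` P"
  proof
    fix q assume q: "q \<in> P"
    then obtain i where i: "i \<in> mspace m2" "\<phi> i = snd q"
      using \<phi>(1) by (metis (no_types, lifting) SigmaE bij_betw_imp_surj_on image_iff snd_conv)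
    obtain x where x: "x \<in> mspace m1" "h i x = fst q"
      using h(1)[of i] q by (metis (no_types, lifting) SigmaE bij_betw_imp_surj_on image_iff fst_conv)
    have "q = g (x, i)" using i x by (simp add: g_def)
    then show "q \<in> g ` P" using i x by blast
  qed
  moreover have "g ` P \<subseteq> P" using gP by (rule image_subsetI)
  ultimately have "bij_betw g P P" unfolding bij_betw_def by blast
  moreover have "isometry_on (fibre_metric m1 m2) P g"
    unfolding isometry_on_def mspace_fibre mdist_fibre using gP g_iso by blast
  moreover have "g p = f p" if "p \<in> A" for p
  proof -
    obtain x i where xi: "p = (x, i)" by fastforce
    have "\<phi> (snd p) = snd (f p)" using \<phi>(3) \<phi>0[OF that] that by simp
    then have "\<phi> i = snd (f p)" using xi by simp
    then have "g (x, i) = f (x, i)" using h(3)[of x i] that xi by (simp add: g_def prod_eq_iff)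
    then show ?thesis using xi by simp
  qed
  ultimately show "\<exists>g. bij_betw g (mspace (fibre_metric m1 m2)) (mspace (fibre_metric m1 m2)) \<and>
      isometry_on (fibre_metric m1 m2) (mspace (fibre_metric m1 m2)) g \<and> (\<forall>x\<in>A. g x = f x)"
    unfolding mspace_fibre by blast
qed

end

lemma admits_compact_times_discrete:
  fixes m :: "'a metric" and D :: "'d set"
  assumes "absolutely_homogeneous m" "compact_space (mtopology_of m)"
    and "\<And>x y. x \<in> mspace m \<Longrightarrow> y \<in> mspace m \<Longrightarrow> mdist m x y \<le> 2"
    and D: "countable D"
  shows "admits_AB_HO_Heine_Borel_metric (prod_topology (mtopology_of m) (discrete_topology D))"
proof -
  obtain m2 where m2: "mspace m2 = D" "topologically_discrete m2" "absolutely_homogeneous m2"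
    "Heine_Borel m2" "\<And>x y. x \<in> D \<Longrightarrow> y \<in> D \<Longrightarrow> x \<noteq> y \<Longrightarrow> 3 \<le> mdist m2 x y"
    using countable_discrete_metric[OF D] by metis
  interpret fibred m m2
    by unfold_locales (use assms(3) m2 in auto)
  show ?thesis
    using fibre_topology fibre_Heine_Borel fibre_absolutely_homogeneous assms m2
    unfolding admits_AB_HO_Heine_Borel_metric_def by metis
qed

section \<open>The Cantor space of binary sequences\<close>

definition agree :: "nat \<Rightarrow> (nat \<Rightarrow> bool) \<Rightarrow> (nat \<Rightarrow> bool) \<Rightarrow> bool" where
  "agree n x y \<longleftrightarrow> (\<forall>i<n. x i = y i)"

lemma agree_Suc: "agree (Suc n) x y \<longleftrightarrow> agree n x y \<and> x n = y n"
  by (auto simp: agree_def less_Suc_eq)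

text \<open>The base 1/3 makes \<open>seq_dist\<close> comparable with the distance of the corresponding points of
  the middle-thirds Cantor set.\<close>

definition seq_dist :: "(nat \<Rightarrow> bool) \<Rightarrow> (nat \<Rightarrow> bool) \<Rightarrow> real" where
  "seq_dist x y = (if x = y then 0 else (1/3) ^ (LEAST n. x n \<noteq> y n))"

lemma first_disagreement:
  assumes "x \<noteq> y"
  obtains n where "agree n x y" "x n \<noteq> y n" "seq_dist x y = (1/3) ^ n"
proof
  let ?n = "LEAST n. x n \<noteq> y n"
  obtain n where "x n \<noteq> y n" using assms by blast
  then show "x ?n \<noteq> y ?n" by (rule LeastI)
  show "agree ?n x y" unfolding agree_def using not_less_Least by blast
  show "seq_dist x y = (1/3) ^ ?n" using assms by (simp add: seq_dist_def)
qed

lemma seq_dist_le_iff: "seq_dist x y \<le> (1/3) ^ n \<longleftrightarrow> agree n x y"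
proof (cases "x = y")
  case True
  then show ?thesis by (simp add: seq_dist_def agree_def)
next
  case False
  then obtain k where k: "agree k x y" "x k \<noteq> y k" "seq_dist x y = (1/3) ^ k"
    using first_disagreement by blast
  have "(1/3::real) ^ k \<le> (1/3) ^ n \<longleftrightarrow> n \<le> k"
    by (rule power_decreasing_iff) auto
  moreover have "agree n x y \<longleftrightarrow> n \<le> k"
    using k(1,2) unfolding agree_def by (metis le_less_linear le_trans not_le)
  ultimately show ?thesis using k(3) by simp
qed

lemma seq_dist_eq_if_agree:
  assumes "\<And>n. agree n x y \<longleftrightarrow> agree n x' y'"
  shows "seq_dist x y = seq_dist x' y'"
proof -
  have eq: "x = y \<longleftrightarrow> (\<forall>n. agree n x y)" for x y by (auto simp: agree_def)
  show ?thesis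
  proof (cases "x = y")
    case True
    then have "x' = y'" using assms eq by blast
    then show ?thesis using True by (simp add: seq_dist_def)
  next
    case False
    then have "x' \<noteq> y'" using assms eq by blast
    then obtain n where n: "seq_dist x' y' = (1/3) ^ n" using first_disagreement by metis
    obtain m where m: "seq_dist x y = (1/3) ^ m" using False first_disagreement by metis
    have "seq_dist x y \<le> (1/3) ^ n" "seq_dist x' y' \<le> (1/3) ^ m"
      using seq_dist_le_iff assms n m by (metis order_refl)+
    then show ?thesis using n m by simp
  qed
qed

interpretation seq: Metric_space "UNIV :: (nat \<Rightarrow> bool) set" seq_dist
proof
  fix x y z :: "nat \<Rightarrow> bool"
  show nonneg: "0 \<le> seq_dist x y" for x y by (simp add: seq_dist_def)
  show "seq_dist x y = seq_dist y x" by (rule seq_dist_eq_if_agree) (auto simp: agree_def)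
  show "seq_dist x y = 0 \<longleftrightarrow> x = y" by (simp add: seq_dist_def)
  show "seq_dist x z \<le> seq_dist x y + seq_dist y z"
  proof (cases "x = z")
    case True
    then show ?thesis using nonneg by (simp add: seq_dist_def)
  next
    case False
    then obtain n where n: "agree n x z" "x n \<noteq> z n" "seq_dist x z = (1/3) ^ n"
      using first_disagreement by blast
    have "x \<noteq> y \<and> seq_dist x z \<le> seq_dist x y \<or> y \<noteq> z \<and> seq_dist x z \<le> seq_dist y z"
    proof (rule ccontr)
      assume c: "\<not> ?thesis"
      have "agree (Suc n) u v" if "u \<noteq> v \<longrightarrow> \<not> seq_dist x z \<le> seq_dist u v" for u v
      proof (cases "u = v")
        case False
        then obtain k where k: "agree k u v" "seq_dist u v = (1/3) ^ k"
          using first_disagreement by blast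
        then have "\<not> (1/3::real) ^ n \<le> (1/3) ^ k" using that False n(3) by simp
        then have "n < k" using power_decreasing[of k n "1/3 :: real"] by linarith
        then show ?thesis using k(1) by (auto simp: agree_def)
      qed (simp add: agree_def)
      then have "agree (Suc n) x y" "agree (Suc n) y z" using c by blast+
      then show False using n(2) by (auto simp: agree_def)
    qed
    then show ?thesis using nonneg[of x y] nonneg[of y z] by linarith
  qed
qed

definition seq_metric :: "(nat \<Rightarrow> bool) metric" where
  "seq_metric = metric (UNIV, seq_dist)"

lemma seq_metric [simp]: "mspace seq_metric = UNIV" "mdist seq_metric = seq_dist"
  by (simp_all add: seq_metric_def)

lemma seq_dist_le_1: "seq_dist x y \<le> 1"
  using seq_dist_le_iff[of x y 0] by (simp add: agree_def)

text \<open>A partial isometry \<open>f\<close> acts on the first \<open>n\<close> bits, and if \<open>a\<close> and \<open>b\<close> in its domain agree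
  there, then it flips the bit \<open>n\<close> of both or of neither.  The extension flips this bit of all
  sequences with the same initial part, and leaves it alone if there is no such \<open>a\<close>.  The
  preimage of a sequence under the extension is found bit by bit.\<close>

lemma seq_metric_absolutely_homogeneous: "absolutely_homogeneous seq_metric"
  unfolding absolutely_homogeneous_def
proof (intro allI impI)
  fix A and f :: "(nat \<Rightarrow> bool) \<Rightarrow> nat \<Rightarrow> bool"
  assume "A \<subseteq> mspace seq_metric \<and> isometry_on seq_metric A f"
  then have f: "agree n (f x) (f y) \<longleftrightarrow> agree n x y" if "x \<in> A" "y \<in> A" for n x y
    using that by (simp add: isometry_on_def flip: seq_dist_le_iff)
  \<comment> \<open>whether \<open>f\<close> flips the bit \<open>n\<close> of a sequence is determined by its earlier bits\<close>
  define \<sigma> where "\<sigma> n x \<longleftrightarrow> (\<exists>a\<in>A. agree n a x \<and> a n \<noteq> f a n)" for n x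
  define g where "g x = (\<lambda>n. x n \<noteq> \<sigma> n x)" for x
  have \<sigma>_cong: "\<sigma> n x = \<sigma> n y" if "agree n x y" for n x y
    using that by (simp add: \<sigma>_def agree_def)
  have "g a = f a" if a: "a \<in> A" for a
  proof
    fix n
    have "\<sigma> n a \<longleftrightarrow> a n \<noteq> f a n"
    proof
      assume "\<sigma> n a"
      then obtain b where b: "b \<in> A" "agree n b a" "b n \<noteq> f b n" by (auto simp: \<sigma>_def)
      then have "f b n = f a n \<longleftrightarrow> b n = a n"
        using f[OF b(1) a, of "Suc n"] f[OF b(1) a, of n] by (simp add: agree_Suc)
      then show "a n \<noteq> f a n" using b(3) by blast
    qed (use a in \<open>auto simp: \<sigma>_def agree_def\<close>)
    then show "g a n = f a n" by (auto simp: g_def)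
  qed
  moreover have g: "agree n (g x) (g y) \<longleftrightarrow> agree n x y" for n x y
  proof (induction n)
    case 0
    then show ?case by (simp add: agree_def)
  next
    case (Suc n)
    then show ?case using \<sigma>_cong[of n x y] by (auto simp: agree_Suc g_def)
  qed
  then have iso: "seq_dist (g x) (g y) = seq_dist x y" for x y
    by (intro seq_dist_eq_if_agree) simp
  moreover have "bij g"
  proof (rule bijI)
    show "inj g"
    proof (rule injI)
      fix x y assume "g x = g y"
      then have "agree n x y" for n using g[of n x y] by (simp add: agree_def)
      then show "x = y" by (auto simp: agree_def)
    qed
    have "\<exists>x. \<forall>n. x n = (y n \<noteq> \<sigma> n x)" for y
    proof (rule dependent_wellorder_choice)
      fix b :: bool and u v :: "nat \<Rightarrow> bool" and n :: nat
      assume "\<And>k. k < n \<Longrightarrow> u k = v k"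
      then have "\<sigma> n u = \<sigma> n v" by (intro \<sigma>_cong) (simp add: agree_def)
      then show "(b = (y n \<noteq> \<sigma> n u)) = (b = (y n \<noteq> \<sigma> n v))" by simp
    qed blast
    then have "\<exists>x. g x = y" for y
      unfolding g_def fun_eq_iff by (metis (full_types))
    then show "surj g" by (metis surjI)
  qed
  ultimately show "\<exists>g. bij_betw g (mspace seq_metric) (mspace seq_metric) \<and>
      isometry_on seq_metric (mspace seq_metric) g \<and> (\<forall>x\<in>A. g x = f x)"
    by (intro exI[of _ g]) (auto simp: isometry_on_def)
qed

section \<open>The middle-thirds Cantor set\<close>

definition cantor_point :: "(nat \<Rightarrow> bool) \<Rightarrow> real" where
  "cantor_point b = (\<Sum>n. 2 * of_bool (b n) / 3 ^ Suc n)"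

lemma cantor_summable: "summable (\<lambda>n. 2 * of_bool (b n) / 3 ^ Suc n :: real)"
proof (rule summable_comparison_test)
  show "\<exists>N. \<forall>n\<ge>N. norm (2 * of_bool (b n) / 3 ^ Suc n :: real) \<le> 2 / 3 * (1/3) ^ n"
    by (auto simp: power_one_over)
  show "summable (\<lambda>n. 2 / 3 * (1/3 :: real) ^ n)"
    by (intro summable_mult summable_geometric) simp
qed

lemma cantor_point_rec: "cantor_point b = (2 * of_bool (b 0) + cantor_point (\<lambda>n. b (Suc n))) / 3"
proof -
  have "cantor_point b = (\<Sum>n. 2 * of_bool (b (Suc n)) / 3 ^ Suc (Suc n)) + 2 * of_bool (b 0) / 3"
    using suminf_split_head[OF cantor_summable[of b]] by (simp add: cantor_point_def)
  also have "(\<Sum>n. 2 * of_bool (b (Suc n)) / 3 ^ Suc (Suc n) :: real) =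
      (\<Sum>n. (2 * of_bool (b (Suc n)) / 3 ^ Suc n) / 3)"
    by (simp add: field_simps)
  also have "\<dots> = cantor_point (\<lambda>n. b (Suc n)) / 3"
    unfolding cantor_point_def by (rule suminf_divide[OF cantor_summable])
  finally show ?thesis by simp
qed

lemma cantor_point_bounds: "0 \<le> cantor_point b" "cantor_point b \<le> 1"
proof -
  show "0 \<le> cantor_point b"
    unfolding cantor_point_def by (rule suminf_nonneg[OF cantor_summable]) simp
  have "cantor_point b \<le> (\<Sum>n. 2 / 3 * (1/3) ^ n)"
    unfolding cantor_point_def
  proof (rule suminf_le[OF _ cantor_summable])
    show "summable (\<lambda>n. 2 / 3 * (1/3 :: real) ^ n)"
      by (intro summable_mult summable_geometric) simp
  qed (auto simp: power_one_over)
  also have "\<dots> = 1"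
    by (subst suminf_mult) (auto simp: suminf_geometric summable_geometric)
  finally show "cantor_point b \<le> 1" .
qed

lemma cantor_point_in: "cantor_point b \<in> cantor_set"
proof -
  have "cantor_point b \<in> cantor_stage k" for k
  proof (induction k arbitrary: b)
    case 0
    then show ?case using cantor_point_bounds by simp
  next
    case (Suc k)
    then show ?case using cantor_point_rec[of b] by (cases "b 0") auto
  qed
  then show ?thesis by (simp add: cantor_set_def)
qed

lemma cantor_stage_bounds: "x \<in> cantor_stage k \<Longrightarrow> 0 \<le> x \<and> x \<le> 1"
  by (induction k arbitrary: x) force+

text \<open>The expanding map of the Cantor set, which acts on ternary expansions as the shift.\<close>

definition cantor_shift :: "real \<Rightarrow> real" where
  "cantor_shift x = (if x \<le> 1/2 then 3 * x else 3 * x - 2)"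

lemma cantor_shift_in:
  assumes "x \<in> cantor_set"
  shows "cantor_shift x \<in> cantor_set"
proof -
  have "cantor_shift x \<in> cantor_stage k" for k
  proof -
    have "x \<in> cantor_stage (Suc k)" using assms by (auto simp: cantor_set_def simp del: cantor_stage.simps)
    then obtain y where y: "y \<in> cantor_stage k" "x = y / 3 \<or> x = (2 + y) / 3" by auto
    then have "cantor_shift x = y" using cantor_stage_bounds[OF y(1)] by (auto simp: cantor_shift_def)
    then show ?thesis using y(1) by simp
  qed
  then show ?thesis by (simp add: cantor_set_def)
qed

text \<open>The binary sequence recorded by the orbit under the shift is the address of \<open>x\<close>: comparing
  both sides after \<open>n\<close> shifts, the error is at most \<open>(1/3) ^ n\<close>.\<close>

lemma cantor_point_surj:
  assumes "x \<in> cantor_set"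
  shows "cantor_point (\<lambda>n. (cantor_shift ^^ n) x > 1/2) = x"
proof -
  define bits where "bits x = (\<lambda>n. (cantor_shift ^^ n) x > 1/2)" for x
  have bits_shift: "(\<lambda>n. bits x (Suc n)) = bits (cantor_shift x)" for x
    by (simp add: bits_def fun_eq_iff funpow_swap1)
  have "\<bar>cantor_point (bits x) - x\<bar> \<le> (1/3) ^ n" if "x \<in> cantor_set" for x n
    using that
  proof (induction n arbitrary: x)
    case 0
    then have "x \<in> cantor_stage 0" unfolding cantor_set_def by blast
    then have "0 \<le> x \<and> x \<le> 1" by (rule cantor_stage_bounds)
    then show ?case using cantor_point_bounds[of "bits x"] by (simp add: abs_le_iff)
  next
    case (Suc n)
    have "x = (2 * of_bool (bits x 0) + cantor_shift x) / 3"
      by (simp add: bits_def cantor_shift_def)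
    then have D: "cantor_point (bits x) - x = (cantor_point (bits (cantor_shift x)) - cantor_shift x) / 3"
      using cantor_point_rec[of "bits x"] by (simp add: bits_shift)
    show ?case using Suc.IH[OF cantor_shift_in[OF Suc.prems]] unfolding D by simp
  qed
  then have *: "\<bar>cantor_point (bits x) - x\<bar> \<le> (1/3) ^ n" for n using assms by blast
  have "(\<lambda>n. (1/3::real) ^ n) \<longlonglongrightarrow> 0" by (rule LIMSEQ_power_zero) simp
  then have "\<bar>cantor_point (bits x) - x\<bar> \<le> 0"
    by (rule LIMSEQ_le_const) (use * in blast)
  then show ?thesis by (simp add: bits_def)
qed

lemma cantor_point_dist_le:
  "agree n b c \<Longrightarrow> \<bar>cantor_point b - cantor_point c\<bar> \<le> (1/3) ^ n"
proof (induction n arbitrary: b c)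
  case 0
  then show ?case using cantor_point_bounds[of b] cantor_point_bounds[of c] by (simp add: abs_le_iff)
next
  case (Suc n)
  then have "b 0 = c 0" "agree n (\<lambda>n. b (Suc n)) (\<lambda>n. c (Suc n))" by (auto simp: agree_def)
  then show ?case
    using Suc.IH[of "\<lambda>n. b (Suc n)" "\<lambda>n. c (Suc n)"] cantor_point_rec[of b] cantor_point_rec[of c]
    by (simp add: abs_le_iff) argo
qed

text \<open>After \<open>n\<close> shifts one of the two points lies in the left and the other in the right third of the
  unit interval.\<close>

lemma cantor_point_dist_ge:
  "agree n b c \<Longrightarrow> b n \<noteq> c n \<Longrightarrow> (1/3) ^ Suc n \<le> \<bar>cantor_point b - cantor_point c\<bar>"
proof (induction n arbitrary: b c)
  case 0
  then show ?case
    using cantor_point_rec[of b] cantor_point_rec[of c]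
      cantor_point_bounds[of "\<lambda>n. b (Suc n)"] cantor_point_bounds[of "\<lambda>n. c (Suc n)"]
    by (cases "b 0"; cases "c 0") auto
next
  case (Suc n)
  then have "b 0 = c 0" "agree n (\<lambda>n. b (Suc n)) (\<lambda>n. c (Suc n))" by (auto simp: agree_def)
  then have D: "cantor_point b - cantor_point c = (cantor_point (\<lambda>n. b (Suc n)) - cantor_point (\<lambda>n. c (Suc n))) / 3"
    using cantor_point_rec[of b] cantor_point_rec[of c] by simp
  show ?case
    using Suc.IH[of "\<lambda>n. b (Suc n)" "\<lambda>n. c (Suc n)"] Suc.prems(2) \<open>agree n (\<lambda>n. b (Suc n)) (\<lambda>n. c (Suc n))\<close>
    unfolding D by simp
qed

lemma cantor_point_bi_Lipschitz:
  "\<bar>cantor_point b - cantor_point c\<bar> \<le> seq_dist b c"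
  "seq_dist b c \<le> 3 * \<bar>cantor_point b - cantor_point c\<bar>"
proof -
  have "\<bar>cantor_point b - cantor_point c\<bar> \<le> seq_dist b c \<and>
      seq_dist b c \<le> 3 * \<bar>cantor_point b - cantor_point c\<bar>"
  proof (cases "b = c")
    case False
    then obtain n where n: "agree n b c" "b n \<noteq> c n" "seq_dist b c = (1/3) ^ n"
      using first_disagreement by blast
    then show ?thesis
      using cantor_point_dist_le[OF n(1)] cantor_point_dist_ge[OF n(1,2)] by simp
  qed (simp add: seq_dist_def)
  then show "\<bar>cantor_point b - cantor_point c\<bar> \<le> seq_dist b c"
    "seq_dist b c \<le> 3 * \<bar>cantor_point b - cantor_point c\<bar>" by auto
qed

lemma cantor_set_homeomorphic: "mtopology_of seq_metric homeomorphic_space top_of_set cantor_set"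
proof -
  let ?C = "submetric euclidean_metric cantor_set"
  define bits where "bits x = (\<lambda>n. (cantor_shift ^^ n) x > 1/2)" for x
  have C: "mtopology_of ?C = top_of_set cantor_set" by (simp add: mtopology_of_submetric)
  have pb: "cantor_point (bits x) = x" if "x \<in> cantor_set" for x
    using cantor_point_surj[OF that] by (simp add: bits_def)
  have bp: "bits (cantor_point b) = b" for b
  proof -
    have "seq_dist (bits (cantor_point b)) b \<le> 3 * \<bar>cantor_point (bits (cantor_point b)) - cantor_point b\<bar>"
      by (rule cantor_point_bi_Lipschitz)
    also have "\<dots> = 0" using pb[OF cantor_point_in] by simp
    finally show ?thesis using seq.nonneg[of "bits (cantor_point b)" b] by (simp add: antisym_conv)
  qed
  have "Lipschitz_continuous_map seq_metric ?C cantor_point"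
    unfolding Lipschitz_continuous_map_def
    using cantor_point_in cantor_point_bi_Lipschitz(1)
    by (auto simp: dist_real_def intro!: exI[of _ 1])
  then have 1: "continuous_map (mtopology_of seq_metric) (top_of_set cantor_set) cantor_point"
    using Lipschitz_continuous_imp_continuous_map C by metis
  have "seq_dist (bits x) (bits y) \<le> 3 * dist x y" if "x \<in> cantor_set" "y \<in> cantor_set" for x y
    using cantor_point_bi_Lipschitz(2)[of "bits x" "bits y"] pb that by (simp add: dist_real_def)
  then have "Lipschitz_continuous_map ?C seq_metric bits"
    unfolding Lipschitz_continuous_map_def by (auto intro!: exI[of _ 3])
  then have 2: "continuous_map (top_of_set cantor_set) (mtopology_of seq_metric) bits"
    using Lipschitz_continuous_imp_continuous_map C by metis
  have "homeomorphic_maps (mtopology_of seq_metric) (top_of_set cantor_set) cantor_point bits"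
    unfolding homeomorphic_maps_def using 1 2 pb bp by auto
  then show ?thesis using homeomorphic_space_def by blast
qed

lemma compact_cantor_set: "compact cantor_set"
proof -
  have "compact (cantor_stage k)" for k
  proof (induction k)
    case (Suc k)
    then show ?case
      by (auto intro!: compact_Un compact_continuous_image continuous_intros)
  qed simp
  then show ?thesis
    unfolding cantor_set_def by (intro compact_Inter) auto
qed

lemma compact_seq_metric: "compact_space (mtopology_of seq_metric)"
  using homeomorphic_compact_space[OF cantor_set_homeomorphic] compact_cantor_set
  by (simp add: compact_space_subtopology)

lemma cantor_set_admits: "admits_AB_HO_Heine_Borel_metric (top_of_set cantor_set)"
proof (rule admits_if_homeomorphic)
  show "admits_AB_HO_Heine_Borel_metric (mtopology_of seq_metric)"
    unfolding admits_AB_HO_Heine_Borel_metric_def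
    using seq_metric_absolutely_homogeneous compact_imp_Heine_Borel[OF compact_seq_metric] by blast
  show "top_of_set cantor_set homeomorphic_space mtopology_of seq_metric"
    using cantor_set_homeomorphic homeomorphic_space_sym by blast
qed

lemma cantor_set_times_discrete_admits:
  fixes D :: "'d set"
  assumes "countable D"
  shows "admits_AB_HO_Heine_Borel_metric (prod_topology (top_of_set cantor_set) (discrete_topology D))"
proof (rule admits_if_homeomorphic)
  show "admits_AB_HO_Heine_Borel_metric (prod_topology (mtopology_of seq_metric) (discrete_topology D))"
  proof (rule admits_compact_times_discrete[OF seq_metric_absolutely_homogeneous compact_seq_metric _ assms])
    show "mdist seq_metric x y \<le> 2" for x y using seq_dist_le_1[of x y] by simp
  qed
  show "prod_topology (top_of_set cantor_set) (discrete_topology D) homeomorphic_space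
      prod_topology (mtopology_of seq_metric) (discrete_topology D)"
    using homeomorphic_space_prod_topology cantor_set_homeomorphic homeomorphic_space_sym
      homeomorphic_space_refl by blast
qed

lemma sphere_times_discrete_admits:
  fixes D :: "'d set"
  assumes "countable D"
  shows "admits_AB_HO_Heine_Borel_metric
    (prod_topology (top_of_set (sphere (0 :: 'a::euclidean_space) 1)) (discrete_topology D))"
proof -
  let ?S = "submetric euclidean_metric (sphere (0 :: 'a) 1)"
  have top: "mtopology_of ?S = top_of_set (sphere 0 1)" by (simp add: mtopology_of_submetric)
  have "compact_space (mtopology_of ?S)"
    unfolding top using compact_sphere by (simp add: compact_space_subtopology)
  moreover have "mdist ?S x y \<le> 2" if "x \<in> mspace ?S" "y \<in> mspace ?S" for x y
    using that dist_triangle[of x y 0] by simp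
  ultimately have "admits_AB_HO_Heine_Borel_metric (prod_topology (mtopology_of ?S) (discrete_topology D))"
    using admits_compact_times_discrete[OF sphere_absolutely_homogeneous _ _ assms] by blast
  then show ?thesis by (simp only: top)
qed

lemma discrete_admits:
  assumes "countable D"
  shows "admits_AB_HO_Heine_Borel_metric (discrete_topology D)"
  using countable_discrete_metric[OF assms]
  unfolding admits_AB_HO_Heine_Borel_metric_def topologically_discrete_def by metis

section \<open>Heine-Borel products and examples of homogeneous Heine-Borel spaces\<close>

theorem theorem4p11:
  shows
  "(\<forall>(S :: 's set) (r :: 's rel) (G :: 's \<Rightarrow> 'a metric) a T.
      productable S G \<and> (\<forall>s\<in>S. absolutely_homogeneous (G s)) \<and>
      linear_order_on S r \<and> a \<in> (\<Pi>\<^sub>E s\<in>S. mspace (G s)) \<and>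
      T = supp S G \<and> (\<exists>s\<in>T. \<exists>t\<in>T. s \<noteq> t) \<and>
      product_is_metric S r G a
      \<longrightarrow>
      (Heine_Borel (product_metric S r G a) \<longleftrightarrow>
         (finite T \<and>
          (\<exists>p q. is_least r T p \<and> is_greatest r T q \<and>
             compact_space (mtopology_of (G q)) \<and>
             Heine_Borel (G p) \<and> topologically_discrete (G p) \<and>
             (\<forall>s\<in>T - {p, q}. finite (mspace (G s)))))
       \<or> (\<exists>p. is_least r T p \<and> order_isomorphic_to r T (UNIV :: nat set) \<and>
             Heine_Borel (G p) \<and> topologically_discrete (G p) \<and>
             (\<forall>s\<in>T - {p}. finite (mspace (G s))) \<and>
             ((\<lambda>s. diam (G s)) \<longlongrightarrow> 0) (increasing_in r T))
       \<or> (\<exists>q. is_greatest r T q \<and> order_isomorphic_to r T {i :: int. i < 0} \<and>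
             compact_space (mtopology_of (G q)) \<and>
             (\<forall>s\<in>T - {q}. finite (mspace (G s))) \<and>
             filterlim (\<lambda>s. codiam (G s)) at_top (decreasing_in r T))
       \<or> (order_isomorphic_to r T (UNIV :: int set) \<and>
             (\<forall>s\<in>T. finite (mspace (G s))) \<and>
             ((\<lambda>s. diam (G s)) \<longlongrightarrow> 0) (increasing_in r T) \<and>
             filterlim (\<lambda>s. codiam (G s)) at_top (decreasing_in r T))))
   \<and>
   (\<forall>(n :: nat) (G :: nat \<Rightarrow> 'b metric) (r :: nat rel) a.
      productable {1..n} G \<and>
      (\<forall>s\<in>{1..n}. absolutely_homogeneous (G s) \<and> Heine_Borel (G s)) \<and>
      r = {(i, j). i \<in> {1..n} \<and> j \<in> {1..n} \<and> i \<le> j} \<and>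
      a \<in> (\<Pi>\<^sub>E s\<in>{1..n}. mspace (G s)) \<and>
      product_is_metric {1..n} r G a
      \<longrightarrow> Heine_Borel (product_metric {1..n} r G a))
   \<and>
   (\<forall>D :: 'd set. countable D \<longrightarrow>
      admits_AB_HO_Heine_Borel_metric (discrete_topology D))
   \<and>
   admits_AB_HO_Heine_Borel_metric (euclidean :: (real^'n) topology)
   \<and>
   \<comment> \<open>the unit sphere of \<open>real^'m\<close> has dimension \<open>CARD('m) - 1 > 0\<close>\<close>
   (CARD('m::finite) \<ge> 2 \<longrightarrow>
      (\<forall>D :: 'd set. countable D \<and> D \<noteq> {} \<longrightarrow>
         admits_AB_HO_Heine_Borel_metric
           (prod_topology (top_of_set (sphere (0 :: real^'m) 1)) (discrete_topology D))))
   \<and>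
   admits_AB_HO_Heine_Borel_metric (top_of_set cantor_set)
   \<and>
   (\<forall>D :: 'd set. countable D \<and> infinite D \<longrightarrow>
      admits_AB_HO_Heine_Borel_metric
        (prod_topology (top_of_set cantor_set) (discrete_topology D)))"
proof (intro conjI allI impI, goal_cases)
  case (1 S r G a T)
  then have T: "T = supp S G" by blast
  interpret product_metric_space S r G a
    by unfold_locales (use 1 in auto)
  have AH: "\<And>s. s \<in> S \<Longrightarrow> absolutely_homogeneous (G s)" using 1 by blast
  have two: "\<exists>s\<in>supp S G. \<exists>t\<in>supp S G. s \<noteq> t" using 1 by blast
  show ?case
    unfolding T by (rule Heine_Borel_product_characterization[OF AH two])
next
  case (2 n G r a)
  have "linear_order_on {1..n} r"
    using 2 by (auto simp: order_on_defs refl_on_def trans_def antisym_def total_on_def)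
  then interpret product_metric_space "{1..n}" r G a
    by unfold_locales (use 2 in auto)
  show ?case
    by (rule finite_product_Heine_Borel) (use 2 in auto)
next
  case (3 D)
  then show ?case by (rule discrete_admits)
next
  case 4
  show ?case by (rule euclidean_admits)
next
  case (5 D)
  then show ?case by (intro sphere_times_discrete_admits) blast
next
  case 6
  show ?case by (rule cantor_set_admits)
next
  case (7 D)
  then show ?case by (intro cantor_set_times_discrete_admits) blast
qed

end
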